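(* Let $G$ be a connected locally finite infinite graph with girth at least $6$. Then $\mathrm{DN}_{\mathrm{LLY}}(G)<\infty$ if and only if exactly one of the following holds: (i) $G$ is a double ray; (ii) $G$ is obtained from a finite tree by attaching one ray.
   Context: Graphs are simple and undirected; the girth of a forest is infinite. Let $d(\cdot,\cdot)$ be the combinatorial graph distance. For a positive edge weight $w:E\to(0,\infty)$ put $d_x^w:=\sum_{y\sim x}w_{xy}$. For $\alpha\in[0,1]$ let $\mu_x^{\alpha,w}$ be the probability measure with $\mu_x^{\alpha,w}(x)=\alpha$, $\mu_x^{\alpha,w}(z)=(1-\alpha)w_{xz}/d_x^w$ for $z\sim x$, and $0$ otherwise. Let $W_1$ be the $1$-Wasserstein distance with respect to $d$. For $x\sim y$ let $\kappa_\alpha^w(x,y):=1-W_1(\mu_x^{\alpha,w},\mu_y^{\alpha,w})$ and define the weighted Lin--Lu--Yau curvature $\kappa_{\mathrm{LLY}}^w(x,y):=\lim_{\alpha\to1^-}\kappa_\alpha^w(x,y)/(1-\alpha)$. For connected locally finite $G$ with $E\neq\varnothing$: $\mathrm{Dist}(w):=\sup_{e\in E}w_e/\inf_{e\in E}w_e$, with value $+\infty$ if the supremum is infinite or the infimum is $0$; a positive weight $w$ is admissible if $\kappa_{\mathrm{LLY}}^w(e)\ge0$ for every $e\in E$; and $\mathrm{DN}_{\mathrm{LLY}}(G):=\inf\{\mathrm{Dist}(w): w \text{ admissible}\}$, with value $+\infty$ if no admissible weight has finite distortion. A ray is a one-way infinite simple path $v_0v_1v_2\cdots$; a double ray is a two-way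 infinite simple path indexed by $\mathbb Z$. "Obtained from a finite tree $K$ by attaching one ray" means: $G$ is the disjoint union of a finite tree $K$ (possibly a single vertex) and a ray $R$, together with one edge joining a vertex of $K$ to the initial vertex of $R$ (so all vertices of $R$ have degree $2$ in $G$). *)

theory Defs
  imports "HOL-Probability.Probability"
begin

text \<open>A simple undirected graph is given by a vertex set \<open>V\<close> and a set \<open>E\<close> of two-element subsets
  of \<open>V\<close>. Edge weights are functions of the unordered edge, so their symmetry is built in; only the
  values on \<open>E\<close> are ever used.\<close>

definition simple_graph :: "'a set \<Rightarrow> 'a set set \<Rightarrow> bool" where
  "simple_graph V E \<longleftrightarrow> (\<forall>e\<in>E. \<exists>x\<in>V. \<exists>y\<in>V. x \<noteq> y \<and> e = {x, y})"

definition nbrs :: "'a set set \<Rightarrow> 'a \<Rightarrow> 'a set" where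
  "nbrs E x = {y. {x, y} \<in> E}"

definition locally_finite :: "'a set \<Rightarrow> 'a set set \<Rightarrow> bool" where
  "locally_finite V E \<longleftrightarrow> (\<forall>x\<in>V. finite (nbrs E x))"

definition walk_betw :: "'a set \<Rightarrow> 'a set set \<Rightarrow> 'a \<Rightarrow> 'a list \<Rightarrow> 'a \<Rightarrow> bool" where
  "walk_betw V E x p y \<longleftrightarrow>
     p \<noteq> [] \<and> set p \<subseteq> V \<and> hd p = x \<and> last p = y \<and> successively (\<lambda>u v. {u, v} \<in> E) p"

definition graph_connected :: "'a set \<Rightarrow> 'a set set \<Rightarrow> bool" where
  "graph_connected V E \<longleftrightarrow> V \<noteq> {} \<and> (\<forall>x\<in>V. \<forall>y\<in>V. \<exists>p. walk_betw V E x p y)"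

text \<open>The length of a walk is its number of edges, one less than the length of the list.\<close>

definition graph_dist :: "'a set \<Rightarrow> 'a set set \<Rightarrow> 'a \<Rightarrow> 'a \<Rightarrow> nat" where
  "graph_dist V E x y = (LEAST n. \<exists>p. walk_betw V E x p y \<and> length p = Suc n)"

text \<open>A cycle is listed without repeating its initial vertex, so its length is the list length.\<close>

definition graph_cycle :: "'a set set \<Rightarrow> 'a list \<Rightarrow> bool" where
  "graph_cycle E c \<longleftrightarrow>
     length c \<ge> 3 \<and> distinct c \<and> successively (\<lambda>u v. {u, v} \<in> E) c \<and> {last c, hd c} \<in> E"

text \<open>The infimum of the empty set is \<open>\<infinity>\<close> in \<^typ>\<open>enat\<close>, hence forests have infinite girth.\<close>

definition girth :: "'a set set \<Rightarrow> enat" where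
  "girth E = (INF c\<in>{c. graph_cycle E c}. enat (length c))"

definition tree :: "'a set \<Rightarrow> 'a set set \<Rightarrow> bool" where
  "tree V E \<longleftrightarrow> simple_graph V E \<and> graph_connected V E \<and> (\<nexists>c. graph_cycle E c)"

definition double_ray :: "'a set \<Rightarrow> 'a set set \<Rightarrow> bool" where
  "double_ray V E \<longleftrightarrow>
     (\<exists>v :: int \<Rightarrow> 'a. inj v \<and> V = range v \<and> E = range (\<lambda>i. {v i, v (i + 1)}))"

definition finite_tree_with_ray :: "'a set \<Rightarrow> 'a set set \<Rightarrow> bool" where
  "finite_tree_with_ray V E \<longleftrightarrow>
     (\<exists>VK EK k. \<exists>r :: nat \<Rightarrow> 'a.
        tree VK EK \<and> finite VK \<and> k \<in> VK \<and> inj r \<and> VK \<inter> range r = {} \<and>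
        V = VK \<union> range r \<and>
        E = EK \<union> range (\<lambda>i. {r i, r (Suc i)}) \<union> {{k, r 0}})"

definition positive_weight :: "'a set set \<Rightarrow> ('a set \<Rightarrow> real) \<Rightarrow> bool" where
  "positive_weight E w \<longleftrightarrow> (\<forall>e\<in>E. w e > 0)"

definition wdeg :: "'a set set \<Rightarrow> ('a set \<Rightarrow> real) \<Rightarrow> 'a \<Rightarrow> real" where
  "wdeg E w x = (\<Sum>y\<in>nbrs E x. w {x, y})"

definition walk_mass :: "'a set set \<Rightarrow> ('a set \<Rightarrow> real) \<Rightarrow> real \<Rightarrow> 'a \<Rightarrow> 'a \<Rightarrow> real" where
  "walk_mass E w \<alpha> x z =
     (if z = x then \<alpha> else if {x, z} \<in> E then (1 - \<alpha>) * w {x, z} / wdeg E w x else 0)"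

definition walk_pmf :: "'a set set \<Rightarrow> ('a set \<Rightarrow> real) \<Rightarrow> real \<Rightarrow> 'a \<Rightarrow> 'a pmf" where
  "walk_pmf E w \<alpha> x = embed_pmf (walk_mass E w \<alpha> x)"

text \<open>The next lemma checks that \<^const>\<open>embed_pmf\<close> is applied to a genuine probability mass function
  at every vertex of finite positive degree.\<close>

lemma pmf_walk_pmf:
  assumes "simple_graph V E" and "positive_weight E w"
    and "finite (nbrs E x)" and "nbrs E x \<noteq> {}" and "0 \<le> \<alpha>" and "\<alpha> \<le> 1"
  shows "pmf (walk_pmf E w \<alpha> x) z = walk_mass E w \<alpha> x z"
proof -
  have pos: "w {x, y} > 0" if "y \<in> nbrs E x" for y
    using assms(2) that by (auto simp: positive_weight_def nbrs_def)
  have D: "wdeg E w x > 0"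
    unfolding wdeg_def using assms(3,4) pos by (intro sum_pos) auto
  have x: "x \<notin> nbrs E x"
    using assms(1) by (force simp: simple_graph_def nbrs_def)
  have nn: "walk_mass E w \<alpha> x z \<ge> 0" for z
    using assms(5,6) D pos[of z] by (auto simp: walk_mass_def nbrs_def)
  let ?A = "insert x (nbrs E x)"
  have "(\<Sum>z\<in>?A. walk_mass E w \<alpha> x z) =
      \<alpha> + (\<Sum>z\<in>nbrs E x. walk_mass E w \<alpha> x z)"
    using assms(3) x by (simp add: walk_mass_def)
  also have "(\<Sum>z\<in>nbrs E x. walk_mass E w \<alpha> x z) =
      (\<Sum>z\<in>nbrs E x. (1 - \<alpha>) / wdeg E w x * w {x, z})"
    using x by (intro sum.cong) (auto simp: walk_mass_def nbrs_def)
  also have "\<dots> = (1 - \<alpha>) / wdeg E w x * wdeg E w x"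
    unfolding wdeg_def by (rule sum_distrib_left[symmetric])
  also have "\<dots> = 1 - \<alpha>"
    using D by simp
  finally have s: "(\<Sum>z\<in>?A. walk_mass E w \<alpha> x z) = 1" by simp
  have "(\<integral>\<^sup>+z. ennreal (walk_mass E w \<alpha> x z) \<partial>count_space UNIV) =
      (\<Sum>z\<in>?A. ennreal (walk_mass E w \<alpha> x z))"
    using assms(3) by (intro nn_integral_count_space') (auto simp: walk_mass_def nbrs_def)
  also have "\<dots> = 1" using s nn by (simp only: sum_ennreal ennreal_1)
  finally show ?thesis
    unfolding walk_pmf_def using nn by (intro pmf_embed_pmf) auto
qed

definition couplings :: "'a pmf \<Rightarrow> 'a pmf \<Rightarrow> ('a \<times> 'a) pmf set" where
  "couplings \<mu> \<nu> = {\<pi>. map_pmf fst \<pi> = \<mu> \<and> map_pmf snd \<pi> = \<nu>}"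

text \<open>Only applied to finitely supported measures, whose couplings are finitely supported as well,
  so integrability is not an issue.\<close>

definition W1 :: "'a set \<Rightarrow> 'a set set \<Rightarrow> 'a pmf \<Rightarrow> 'a pmf \<Rightarrow> real" where
  "W1 V E \<mu> \<nu> =
     (INF \<pi>\<in>couplings \<mu> \<nu>. measure_pmf.expectation \<pi> (\<lambda>(u, v). real (graph_dist V E u v)))"

definition kappa ::
  "'a set \<Rightarrow> 'a set set \<Rightarrow> ('a set \<Rightarrow> real) \<Rightarrow> real \<Rightarrow> 'a \<Rightarrow> 'a \<Rightarrow> real" where
  "kappa V E w \<alpha> x y = 1 - W1 V E (walk_pmf E w \<alpha> x) (walk_pmf E w \<alpha> y)"

definition kappa_LLY :: "'a set \<Rightarrow> 'a set set \<Rightarrow> ('a set \<Rightarrow> real) \<Rightarrow> 'a \<Rightarrow> 'a \<Rightarrow> real" where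
  "kappa_LLY V E w x y = Lim (at_left 1) (\<lambda>\<alpha>. kappa V E w \<alpha> x y / (1 - \<alpha>))"

definition admissible :: "'a set \<Rightarrow> 'a set set \<Rightarrow> ('a set \<Rightarrow> real) \<Rightarrow> bool" where
  "admissible V E w \<longleftrightarrow>
     positive_weight E w \<and> (\<forall>x y. {x, y} \<in> E \<longrightarrow> kappa_LLY V E w x y \<ge> 0)"

definition distortion :: "'a set set \<Rightarrow> ('a set \<Rightarrow> real) \<Rightarrow> ereal" where
  "distortion E w =
     (if bdd_above (w ` E) \<and> (INF e\<in>E. w e) \<noteq> 0
      then ereal ((SUP e\<in>E. w e) / (INF e\<in>E. w e)) else \<infinity>)"

definition DN_LLY :: "'a set \<Rightarrow> 'a set set \<Rightarrow> ereal" where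
  "DN_LLY V E = (INF w\<in>{w. admissible V E w}. distortion E w)"

end

theory Submission
  imports Defs
begin

text \<open>In girth at least 6 the balls around adjacent \<open>x, y\<close> look like a tree, which gives
  \<open>\<kappa>(x, y) = 2 (w\<^sub>x\<^sub>y / d\<^sub>x + w\<^sub>x\<^sub>y / d\<^sub>y) - 2\<close>. So \<open>w\<close> is admissible iff
  \<open>(d\<^sub>x - w\<^sub>x\<^sub>y) (d\<^sub>y - w\<^sub>x\<^sub>y) \<le> w\<^sub>x\<^sub>y\<^sup>2\<close> on every edge. In particular weights are log-concave along
  non-backtracking walks; if they are bounded away from 0, they cannot decrease along an infinite one.
  An edge from which one can walk to infinity in both directions therefore forces equality, both of
  its ends have degree 2, and this spreads over the whole graph. If there is no such edge, then there is no
  cycle either, and walks to infinity orient all edges towards a single end. On the way there, every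
  vertex of degree at least 3 makes the weight grow by a fixed amount, so boundedness leaves only finitely
  many of them. Conversely, the constant weight works on the double ray, and on a finite tree
  with a ray one may take weight 1 on the ray and weights decaying fast enough away from it.\<close>

section \<open>Walks and distances\<close>

lemma short_cycle_free:
  assumes "girth E \<ge> 6" "graph_cycle E c"
  shows "length c \<ge> 6"
proof -
  have "girth E \<le> enat (length c)"
    unfolding girth_def using assms(2) by (intro INF_lower) auto
  then have "6 \<le> enat (length c)" using assms(1) by (rule order_trans[rotated])
  then show ?thesis by (metis enat_ord_simps(1) numeral_eq_enat)
qed

text \<open>A walk that starts in \<open>S\<close> cannot leave it. Most later uses of connectedness
  go through such neighbour-closed sets instead of explicit walks.\<close>

lemma graph_connected_closed:
  assumes "graph_connected V E" "u \<in> V" "u \<in> S" "\<And>v. v \<in> S \<Longrightarrow> nbrs E v \<subseteq> S"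
  shows "V \<subseteq> S"
proof
  fix y assume "y \<in> V"
  then obtain p where "walk_betw V E u p y"
    using assms(1,2) by (auto simp: graph_connected_def)
  then have "p \<noteq> []" "hd p \<in> S" "last p = y" "successively (\<lambda>u v. {u, v} \<in> E) p"
    using assms(3) by (auto simp: walk_betw_def)
  then show "y \<in> S"
  proof (induction p)
    case (Cons a p)
    then show ?case
      using assms(4)[of a] by (cases p) (auto simp: nbrs_def)
  qed simp
qed

lemma walk_betw_rev: "walk_betw V E x p y \<Longrightarrow> walk_betw V E y (rev p) x"
  by (auto simp: walk_betw_def hd_rev last_rev insert_commute)

lemma walk_betw_append:
  assumes p: "walk_betw V E x p y" and q: "walk_betw V E y q z"
  shows "walk_betw V E x (p @ tl q) z"
proof -
  obtain q' where q': "q = y # q'" using q by (cases q) (simp_all add: walk_betw_def)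
  show ?thesis
  proof (cases q')
    case Nil
    then show ?thesis using p q q' by (simp add: walk_betw_def)
  next
    case (Cons a l)
    then show ?thesis using p q q' by (simp add: walk_betw_def successively_append_iff)
  qed
qed

text \<open>Applied to the set of vertices reachable from \<open>v\<close>, the closure hypothesis
  shows that this set is everything; two vertices are then joined through \<open>v\<close>.\<close>

lemma graph_connectedI:
  assumes "simple_graph V E" "v \<in> V"
    and closed: "\<And>S. v \<in> S \<Longrightarrow> (\<And>u. u \<in> S \<Longrightarrow> nbrs E u \<subseteq> S) \<Longrightarrow> V \<subseteq> S"
  shows "graph_connected V E"
proof -
  have "V \<subseteq> {u. \<exists>p. walk_betw V E v p u}"
  proof (rule closed)
    have "walk_betw V E v [v] v" using assms(2) by (simp add: walk_betw_def)
    then show "v \<in> {u. \<exists>p. walk_betw V E v p u}" by blast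
    fix u assume "u \<in> {u. \<exists>p. walk_betw V E v p u}"
    then obtain p where p: "walk_betw V E v p u" by blast
    have "walk_betw V E v (p @ tl [u, y]) y" if "y \<in> nbrs E u" for y
    proof (rule walk_betw_append[OF p])
      show "walk_betw V E u [u, y] y"
        using that assms(1) by (auto simp: walk_betw_def nbrs_def simple_graph_def doubleton_eq_iff)
    qed
    then show "nbrs E u \<subseteq> {u. \<exists>p. walk_betw V E v p u}" by blast
  qed
  then have reach: "\<exists>p. walk_betw V E v p u" if "u \<in> V" for u using that by blast
  have "\<exists>p. walk_betw V E x p y" if "x \<in> V" "y \<in> V" for x y
  proof -
    from reach[OF \<open>x \<in> V\<close>] obtain p where p: "walk_betw V E v p x" ..
    from reach[OF \<open>y \<in> V\<close>] obtain q where q: "walk_betw V E v q y" ..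
    show ?thesis using walk_betw_append[OF walk_betw_rev[OF p] q] by blast
  qed
  then show ?thesis using assms(2) by (auto simp: graph_connected_def)
qed

lemma graph_dist_walk:
  assumes "graph_connected V E" "u \<in> V" "v \<in> V"
  obtains p where "walk_betw V E u p v" "length p = Suc (graph_dist V E u v)"
proof -
  obtain p where p: "walk_betw V E u p v" using assms by (auto simp: graph_connected_def)
  then have "length p = Suc (length p - 1)" by (cases p) (auto simp: walk_betw_def)
  with p have "\<exists>n p. walk_betw V E u p v \<and> length p = Suc n" by blast
  then have "\<exists>p. walk_betw V E u p v \<and> length p = Suc (graph_dist V E u v)"
    unfolding graph_dist_def by (rule LeastI_ex)
  with that show ?thesis by blast
qed

lemma graph_dist_le:
  assumes "walk_betw V E u p v" "length p = Suc n"
  shows "graph_dist V E u v \<le> n"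
  unfolding graph_dist_def using assms by (intro Least_le) blast

locale lf_graph =
  fixes V :: "'a set" and E :: "'a set set"
  assumes simple: "simple_graph V E"
    and conn: "graph_connected V E"
    and lf: "locally_finite V E"
begin

lemma edgeD: "{x, y} \<in> E \<Longrightarrow> x \<in> V \<and> y \<in> V \<and> x \<noteq> y"
  using simple by (fastforce simp: simple_graph_def doubleton_eq_iff)

lemma nbrsD: "y \<in> nbrs E x \<Longrightarrow> x \<in> V \<and> y \<in> V \<and> x \<noteq> y"
  using edgeD by (simp add: nbrs_def)

lemma finite_nbrs: "finite (nbrs E x)"
proof (cases "x \<in> V")
  case False
  then have "nbrs E x = {}" using nbrsD by blast
  then show ?thesis by simp
qed (use lf in \<open>auto simp: locally_finite_def\<close>)

lemma edgeE:
  assumes "e \<in> E" obtains x y where "e = {x, y}" "{x, y} \<in> E"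
  using assms simple by (force simp: simple_graph_def)

lemma dist_pos: "u \<in> V \<Longrightarrow> v \<in> V \<Longrightarrow> u \<noteq> v \<Longrightarrow> graph_dist V E u v \<ge> 1"
  by (rule graph_dist_walk[OF conn, of u v])
     (auto simp: walk_betw_def length_Suc_conv intro!: Suc_leI gr0I)

lemma dist_ge_2:
  assumes "u \<in> V" "v \<in> V" "u \<noteq> v" "{u, v} \<notin> E"
  shows "graph_dist V E u v \<ge> 2"
proof -
  obtain p where p: "walk_betw V E u p v" "length p = Suc (graph_dist V E u v)"
    using graph_dist_walk[OF conn assms(1,2)] .
  have "graph_dist V E u v \<noteq> 1"
    using p assms(4) by (auto simp: walk_betw_def length_Suc_conv numeral_2_eq_2)
  with dist_pos[OF assms(1-3)] show ?thesis by linarith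
qed

lemma dist_ge_3:
  assumes "u \<in> V" "v \<in> V" "u \<noteq> v" "{u, v} \<notin> E" "\<And>a. {u, a} \<in> E \<Longrightarrow> {a, v} \<notin> E"
  shows "graph_dist V E u v \<ge> 3"
proof -
  obtain p where p: "walk_betw V E u p v" "length p = Suc (graph_dist V E u v)"
    using graph_dist_walk[OF conn assms(1,2)] .
  have "graph_dist V E u v \<noteq> 2"
    using p assms(5) by (auto simp: walk_betw_def length_Suc_conv numeral_2_eq_2)
  with dist_ge_2[OF assms(1-4)] show ?thesis by linarith
qed

end

section \<open>The Lin--Lu--Yau curvature in girth at least 6\<close>

lemma expectation_walk_pmf:
  fixes f :: "'a \<Rightarrow> real"
  assumes "simple_graph V E" "positive_weight E w" "finite (nbrs E x)" "nbrs E x \<noteq> {}"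
    and "0 \<le> \<alpha>" "\<alpha> \<le> 1"
  shows "measure_pmf.expectation (walk_pmf E w \<alpha> x) f =
    \<alpha> * f x + (1 - \<alpha>) / wdeg E w x * (\<Sum>z\<in>nbrs E x. w {x, z} * f z)"
proof -
  note pmf = pmf_walk_pmf[OF assms]
  have x: "x \<notin> nbrs E x"
    using assms(1) by (force simp: simple_graph_def nbrs_def)
  have "measure_pmf.expectation (walk_pmf E w \<alpha> x) f =
      (\<Sum>z\<in>insert x (nbrs E x). f z * pmf (walk_pmf E w \<alpha> x) z)"
    using assms(3) pmf
    by (intro integral_measure_pmf_real) (auto simp: walk_mass_def nbrs_def set_pmf_iff split: if_splits)
  also have "\<dots> = \<alpha> * f x + (\<Sum>z\<in>nbrs E x. f z * walk_mass E w \<alpha> x z)"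
    using assms(3) x by (simp add: pmf walk_mass_def)
  also have "(\<Sum>z\<in>nbrs E x. f z * walk_mass E w \<alpha> x z) =
      (\<Sum>z\<in>nbrs E x. (1 - \<alpha>) / wdeg E w x * (w {x, z} * f z))"
    using x by (intro sum.cong) (auto simp: walk_mass_def nbrs_def)
  finally show ?thesis by (simp add: sum_distrib_left)
qed

lemma set_walk_pmf:
  assumes "simple_graph V E" "positive_weight E w" "finite (nbrs E x)" "nbrs E x \<noteq> {}"
    and "0 \<le> \<alpha>" "\<alpha> \<le> 1"
  shows "set_pmf (walk_pmf E w \<alpha> x) \<subseteq> insert x (nbrs E x)"
  by (auto simp: set_pmf_iff pmf_walk_pmf[OF assms] walk_mass_def nbrs_def split: if_splits)

locale girth6_graph = lf_graph +
  assumes girth6: "girth E \<ge> 6"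
begin

lemma no_short_cycle: "graph_cycle E c \<Longrightarrow> length c \<ge> 6"
  using girth6 short_cycle_free by blast

lemma no_triangle: "{x, y} \<in> E \<Longrightarrow> {y, z} \<in> E \<Longrightarrow> {z, x} \<notin> E"
  using no_short_cycle[of "[x, y, z]"] edgeD by (auto simp: graph_cycle_def)

text \<open>A shorter connection between \<open>z\<close> and \<open>z'\<close> would close up to a
  cycle of length 3, 4 or 5. The girth bound enters the whole proof only here and in
  \<open>no_triangle\<close>.\<close>

lemma dist_outer:
  assumes "{x, y} \<in> E" "{x, z} \<in> E" "z \<noteq> y" "{y, z'} \<in> E" "z' \<noteq> x"
  shows "graph_dist V E z z' \<ge> 3"
proof (rule dist_ge_3)
  note ne = edgeD[OF assms(1)] edgeD[OF assms(2)] edgeD[OF assms(4)]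
  show "z \<in> V" "z' \<in> V" using ne by auto
  show zz: "z \<noteq> z'" using assms no_triangle[of x y z] by (auto simp: insert_commute)
  show "{z, z'} \<notin> E"
  proof
    assume "{z, z'} \<in> E"
    then have "graph_cycle E [x, z, z', y]"
      using ne assms zz by (auto simp: graph_cycle_def insert_commute)
    from no_short_cycle[OF this] show False by simp
  qed
  fix a assume a: "{z, a} \<in> E"
  show "{a, z'} \<notin> E"
  proof
    assume b: "{a, z'} \<in> E"
    have "a \<noteq> x" using b assms no_triangle[of x y z'] by (auto simp: insert_commute)
    moreover have "a \<noteq> y" using a assms no_triangle[of x y z] by (auto simp: insert_commute)
    ultimately have "graph_cycle E [x, z, a, z', y]"
      using ne assms zz a b edgeD[OF a] edgeD[OF b] by (auto simp: graph_cycle_def insert_commute)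
    from no_short_cycle[OF this] show False by simp
  qed
qed

text \<open>Kantorovich duality by hand: the potential \<open>f\<close> bounds the cost of every
  coupling from below, and the coupling \<open>\<pi>0\<close> attains the bound. The laziness
  \<open>\<beta>\<close> is nonnegative because \<alpha> is at least 1/2. It solves
  \<open>\<alpha> * (1 - \<beta>) = 1 - \<alpha>\<close>, so \<open>x\<close> sends to the
  neighbours of \<open>y\<close> exactly the mass that they carry under the second measure.\<close>

lemma W1_walk_pmf:
  fixes w :: "'a set \<Rightarrow> real"
  assumes xy: "{x, y} \<in> E" and w: "positive_weight E w" and \<alpha>: "1 / 2 \<le> \<alpha>" "\<alpha> < 1"
  shows "W1 V E (walk_pmf E w \<alpha> x) (walk_pmf E w \<alpha> y) =
    1 + (1 - \<alpha>) * (2 - 2 * (w {x, y} / wdeg E w x + w {x, y} / wdeg E w y))"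
proof -
  let ?d = "\<lambda>u v. real (graph_dist V E u v)"
  let ?X = "walk_pmf E w \<alpha> x" and ?Y = "walk_pmf E w \<alpha> y"
  \<comment> \<open>The values 3, 2, 1, 0 are the levels of the outer neighbours of
    \<open>x\<close>, of \<open>x\<close>, of \<open>y\<close> and of the outer neighbours of
    \<open>y\<close>. The test for \<open>y\<close> must precede the one for
    \<open>nbrs E x\<close>, which contains \<open>y\<close>.\<close>
  define f :: "'a \<Rightarrow> real" where
    "f = (\<lambda>v. if v = x then 2 else if v = y then 1 else if v \<in> nbrs E x then 3 else 0)"
  have ne: "x \<noteq> y" "x \<in> V" "y \<in> V" and nx: "y \<in> nbrs E x" and ny: "x \<in> nbrs E y"
    using edgeD[OF xy] xy by (auto simp: nbrs_def insert_commute)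
  have not_xx: "x \<notin> nbrs E x" "y \<notin> nbrs E y" using nbrsD by blast+
  have ne0: "nbrs E x \<noteq> {}" "nbrs E y \<noteq> {}" using nx ny by auto
  have pos: "w {a, b} > 0" if "b \<in> nbrs E a" for a b
    using w that by (auto simp: positive_weight_def nbrs_def)
  have dpos: "wdeg E w x > 0" "wdeg E w y > 0"
    unfolding wdeg_def using finite_nbrs ne0 pos by (auto intro!: sum_pos)
  have \<alpha>': "0 \<le> \<alpha>" "\<alpha> \<le> 1" using \<alpha> by auto
  note wx = simple w finite_nbrs ne0(1) and wy = simple w finite_nbrs ne0(2)
  have far: "z' \<notin> nbrs E x" if "z' \<in> nbrs E y" for z'
    using that no_triangle[OF xy, of z'] by (auto simp: nbrs_def insert_commute)

  have "(\<Sum>z\<in>nbrs E x. w {x, z} * f z) =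
      w {x, y} * f y + (\<Sum>z\<in>nbrs E x - {y}. w {x, z} * f z)"
    by (rule sum.remove[OF finite_nbrs nx])
  also have "(\<Sum>z\<in>nbrs E x - {y}. w {x, z} * f z) = (\<Sum>z\<in>nbrs E x - {y}. w {x, z} * 3)"
    using not_xx by (intro sum.cong) (auto simp: f_def)
  also have "\<dots> = 3 * (wdeg E w x - w {x, y})"
    using sum.remove[OF finite_nbrs nx, of "\<lambda>z. w {x, z}"]
    by (simp add: wdeg_def sum_distrib_right[symmetric])
  finally have Ex: "measure_pmf.expectation ?X f =
      2 * \<alpha> + (1 - \<alpha>) / wdeg E w x * (w {x, y} + 3 * (wdeg E w x - w {x, y}))"
    using ne by (simp add: expectation_walk_pmf[OF wx \<alpha>'] f_def)

  have "(\<Sum>z\<in>nbrs E y. w {y, z} * f z) =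
      w {y, x} * f x + (\<Sum>z\<in>nbrs E y - {x}. w {y, z} * f z)"
    by (rule sum.remove[OF finite_nbrs ny])
  also have "(\<Sum>z\<in>nbrs E y - {x}. w {y, z} * f z) = 0"
    using not_xx far by (intro sum.neutral) (auto simp: f_def)
  finally have Ey: "measure_pmf.expectation ?Y f =
      \<alpha> + (1 - \<alpha>) / wdeg E w y * (2 * w {x, y})"
    using ne by (simp add: expectation_walk_pmf[OF wy \<alpha>'] f_def insert_commute)

  have val: "measure_pmf.expectation ?X f - measure_pmf.expectation ?Y f =
      1 + (1 - \<alpha>) * (2 - 2 * (w {x, y} / wdeg E w x + w {x, y} / wdeg E w y))"
    unfolding Ex Ey using dpos by (simp add: divide_simps) (simp add: algebra_simps)

  have sX: "set_pmf ?X \<subseteq> insert x (nbrs E x)" by (rule set_walk_pmf[OF wx \<alpha>'])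
  have sY: "set_pmf ?Y \<subseteq> insert y (nbrs E y)" by (rule set_walk_pmf[OF wy \<alpha>'])

  have coup: "finite (set_pmf \<pi>)"
      "measure_pmf.expectation \<pi> (\<lambda>(u, v). f u - f v) =
       measure_pmf.expectation ?X f - measure_pmf.expectation ?Y f"
      "set_pmf \<pi> \<subseteq> insert x (nbrs E x) \<times> insert y (nbrs E y)"
    if "\<pi> \<in> couplings ?X ?Y" for \<pi>
  proof -
    have X: "?X = map_pmf fst \<pi>" and Y: "?Y = map_pmf snd \<pi>"
      using that by (auto simp: couplings_def)
    show sub: "set_pmf \<pi> \<subseteq> insert x (nbrs E x) \<times> insert y (nbrs E y)"
      using sX sY unfolding X Y by force
    show fin: "finite (set_pmf \<pi>)"
      by (rule finite_subset[OF sub]) (use finite_nbrs in auto)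
    show "measure_pmf.expectation \<pi> (\<lambda>(u, v). f u - f v) =
       measure_pmf.expectation ?X f - measure_pmf.expectation ?Y f"
      unfolding X Y integral_map_pmf
      by (subst Bochner_Integration.integral_diff[symmetric])
         (auto intro!: integrable_measure_pmf_finite fin simp: case_prod_unfold)
  qed

  \<comment> \<open>Couplings live on the product of these two neighbourhoods, so the bound is
    proved there. A drop of 3 occurs only between outer neighbours on opposite sides, where
    \<open>dist_outer\<close> applies.\<close>
  have lip: "f u - f v \<le> ?d u v" if "u \<in> insert x (nbrs E x)" "v \<in> insert y (nbrs E y)" for u v
  proof -
    have V: "u \<in> V" "v \<in> V" using that ne nbrsD by auto
    consider "u = y" | "u = x" "v = x" | "u = x" "v = y" | "u = x" "v \<noteq> x" "v \<noteq> y"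
      | "u \<noteq> x" "u \<noteq> y" "v = x" | "u \<noteq> x" "u \<noteq> y" "v = y" | "u \<noteq> x" "u \<noteq> y" "v \<noteq> x" "v \<noteq> y"
      by blast
    then show ?thesis
    proof cases
      case 1
      show ?thesis
      proof (cases "v = y \<or> v = x")
        case False
        then show ?thesis using 1 V dist_pos[of u v] ne by (auto simp: f_def)
      qed (use 1 ne in \<open>auto simp: f_def\<close>)
    next
      case 2 then show ?thesis by simp
    next
      case 3 then show ?thesis using V dist_pos[of u v] ne by (simp add: f_def)
    next
      case 4
      then have "{u, v} \<notin> E" using that far[of v] by (auto simp: nbrs_def)
      then show ?thesis using 4 V dist_ge_2[of u v] that far[of v] by (simp add: f_def)
    next
      case 5 then show ?thesis using V that dist_pos[of u v] by (simp add: f_def)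
    next
      case 6
      then have "{u, v} \<notin> E" using that far[of u] by (auto simp: nbrs_def insert_commute)
      then show ?thesis using 6 V dist_ge_2[of u v] that ne by (simp add: f_def)
    next
      case 7
      then have "graph_dist V E u v \<ge> 3"
        using dist_outer[OF xy, of u v] that by (auto simp: nbrs_def)
      then show ?thesis using 7 that far[of v] by (simp add: f_def)
    qed
  qed

  \<comment> \<open>An optimal coupling: everything outside \<open>x\<close> moves to \<open>y\<close>, and the mass at \<open>x\<close> is spread by a
    walk from \<open>y\<close> whose laziness \<open>\<beta>\<close> is adjusted so that the second marginal comes out right.\<close>
  define \<beta> where "\<beta> = (2 * \<alpha> - 1) / \<alpha>"
  have \<beta>: "0 \<le> \<beta>" "\<beta> \<le> 1" using \<alpha> by (auto simp: \<beta>_def divide_simps)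
  define \<pi>0 where "\<pi>0 = bind_pmf ?X
    (\<lambda>u. if u = x then map_pmf (Pair x) (walk_pmf E w \<beta> y) else return_pmf (u, y))"
  have "map_pmf fst \<pi>0 = bind_pmf ?X return_pmf"
    unfolding \<pi>0_def map_bind_pmf
    by (intro bind_pmf_cong) (auto simp: map_pmf_comp)
  moreover have "map_pmf snd \<pi>0 = ?Y"
  proof (rule pmf_eqI)
    fix v
    have "map_pmf snd \<pi>0 = bind_pmf ?X (\<lambda>u. if u = x then walk_pmf E w \<beta> y else return_pmf y)"
      unfolding \<pi>0_def map_bind_pmf by (intro bind_pmf_cong) (auto simp: map_pmf_comp)
    then have "pmf (map_pmf snd \<pi>0) v = measure_pmf.expectation ?X
        (\<lambda>u. if u = x then pmf (walk_pmf E w \<beta> y) v else indicator {y} v)"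
      by (auto simp: pmf_bind indicator_def pmf_return intro!: Bochner_Integration.integral_cong)
    also have "\<dots> = \<alpha> * pmf (walk_pmf E w \<beta> y) v + (1 - \<alpha>) / wdeg E w x *
        (\<Sum>z\<in>nbrs E x. w {x, z} * (if z = x then pmf (walk_pmf E w \<beta> y) v else indicator {y} v))"
      by (simp add: expectation_walk_pmf[OF wx \<alpha>'])
    also have "(\<Sum>z\<in>nbrs E x. w {x, z} * (if z = x then pmf (walk_pmf E w \<beta> y) v else indicator {y} v))
        = (\<Sum>z\<in>nbrs E x. w {x, z} * indicator {y} v)"
      using not_xx by (intro sum.cong) auto
    also have "\<dots> = wdeg E w x * indicator {y} v"
      by (simp add: wdeg_def sum_distrib_right)
    also have "pmf (walk_pmf E w \<beta> y) v = walk_mass E w \<beta> y v"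
      by (rule pmf_walk_pmf[OF wy \<beta>])
    also have "\<alpha> * walk_mass E w \<beta> y v + (1 - \<alpha>) / wdeg E w x * (wdeg E w x * indicator {y} v)
        = walk_mass E w \<alpha> y v"
    proof -
      have b: "\<alpha> * (1 - \<beta>) = 1 - \<alpha>" "\<alpha> * \<beta> + (1 - \<alpha>) = \<alpha>"
        using \<alpha> by (auto simp: \<beta>_def field_simps)
      show ?thesis
        using dpos b by (auto simp: walk_mass_def mult.assoc[symmetric])
    qed
    also have "\<dots> = pmf ?Y v" by (rule pmf_walk_pmf[OF wy \<alpha>', symmetric])
    finally show "pmf (map_pmf snd \<pi>0) v = pmf ?Y v" .
  qed
  ultimately have \<pi>0: "\<pi>0 \<in> couplings ?X ?Y" by (simp add: couplings_def bind_return_pmf')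

  \<comment> \<open>\<open>\<pi>0\<close> moves mass along explicit walks with at most 2 edges, on
    which the potential drops by at least their length; together with \<open>lip\<close> this is
    equality.\<close>
  have tight: "?d u v \<le> f u - f v" if "(u, v) \<in> set_pmf \<pi>0" for u v
  proof -
    have uX: "u \<in> insert x (nbrs E x)" and vY: "v \<in> insert y (nbrs E y)"
      using coup(3)[OF \<pi>0] that by auto
    have V: "u \<in> V" "v \<in> V" using uX vY ne nbrsD by auto
    have "u = x \<or> v = y" using that by (auto simp: \<pi>0_def split: if_splits)
    then consider "u = v" | "u = x" "v = y" | "u = x" "v \<noteq> x" "v \<noteq> y" | "u \<noteq> x" "u \<noteq> y" "v = y"
      by blast
    then show ?thesis
    proof cases
      case 1
      have "walk_betw V E u [u] v" using V 1 by (simp add: walk_betw_def)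
      from graph_dist_le[OF this, of 0] show ?thesis using 1 by simp
    next
      case 2
      have "walk_betw V E u [x, y] v" using V 2 xy by (simp add: walk_betw_def)
      from graph_dist_le[OF this, of 1] show ?thesis using 2 ne by (simp add: f_def)
    next
      case 3
      have "walk_betw V E u [x, y, v] v" using V 3 xy vY ne by (simp add: walk_betw_def nbrs_def)
      from graph_dist_le[OF this, of 2] show ?thesis using 3 far[of v] vY by (simp add: f_def)
    next
      case 4
      have "walk_betw V E u [u, x, y] v"
        using V 4 xy uX ne by (simp add: walk_betw_def nbrs_def insert_commute)
      from graph_dist_le[OF this, of 2] show ?thesis using 4 uX ne by (simp add: f_def)
    qed
  qed

  have lower: "measure_pmf.expectation ?X f - measure_pmf.expectation ?Y f
      \<le> measure_pmf.expectation \<pi> (\<lambda>(u, v). ?d u v)" if "\<pi> \<in> couplings ?X ?Y" for \<pi>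
    unfolding coup(2)[OF that, symmetric]
    using coup(3)[OF that] lip
    by (intro integral_mono_AE integrable_measure_pmf_finite coup(1)[OF that])
       (auto simp: AE_measure_pmf_iff)
  have "measure_pmf.expectation \<pi>0 (\<lambda>(u, v). ?d u v)
      \<le> measure_pmf.expectation \<pi>0 (\<lambda>(u, v). f u - f v)"
    using tight
    by (intro integral_mono_AE integrable_measure_pmf_finite coup(1)[OF \<pi>0])
       (auto simp: AE_measure_pmf_iff)
  then have upper: "measure_pmf.expectation \<pi>0 (\<lambda>(u, v). ?d u v)
      = measure_pmf.expectation ?X f - measure_pmf.expectation ?Y f"
    using lower[OF \<pi>0] coup(2)[OF \<pi>0] by simp
  have "W1 V E ?X ?Y = measure_pmf.expectation ?X f - measure_pmf.expectation ?Y f"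
    unfolding W1_def
  proof (rule cInf_eq_minimum)
    show "measure_pmf.expectation ?X f - measure_pmf.expectation ?Y f
        \<in> (\<lambda>\<pi>. measure_pmf.expectation \<pi> (\<lambda>(u, v). ?d u v)) ` couplings ?X ?Y"
      using upper \<pi>0 by force
  qed (use lower in auto)
  with val show ?thesis by simp
qed

text \<open>By \<open>W1_walk_pmf\<close> the quotient is constant for \<alpha> strictly between 1/2
  and 1, so the limit is read off from eventual equality.\<close>

lemma kappa_LLY_eq:
  assumes "{x, y} \<in> E" "positive_weight E w"
  shows "kappa_LLY V E w x y = 2 * (w {x, y} / wdeg E w x + w {x, y} / wdeg E w y) - 2"
  unfolding kappa_LLY_def
proof (rule tendsto_Lim)
  have "eventually (\<lambda>\<alpha>. kappa V E w \<alpha> x y / (1 - \<alpha>) =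
      2 * (w {x, y} / wdeg E w x + w {x, y} / wdeg E w y) - 2) (at_left (1 :: real))"
  proof (rule eventually_mono)
    show "eventually (\<lambda>\<alpha>. \<alpha> \<in> {1 / 2<..<1}) (at_left (1 :: real))"
      by (rule eventually_at_left_real) simp
    fix \<alpha> :: real assume \<alpha>: "\<alpha> \<in> {1 / 2<..<1}"
    define c where "c = w {x, y} / wdeg E w x + w {x, y} / wdeg E w y"
    have "kappa V E w \<alpha> x y = (1 - \<alpha>) * (2 * c - 2)"
      unfolding kappa_def c_def using W1_walk_pmf[OF assms, of \<alpha>] \<alpha> by (simp add: algebra_simps)
    then show "kappa V E w \<alpha> x y / (1 - \<alpha>) =
        2 * (w {x, y} / wdeg E w x + w {x, y} / wdeg E w y) - 2"
      using \<alpha> by (simp add: c_def)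
  qed
  then show "((\<lambda>\<alpha>. kappa V E w \<alpha> x y / (1 - \<alpha>)) \<longlongrightarrow>
      2 * (w {x, y} / wdeg E w x + w {x, y} / wdeg E w y) - 2) (at_left 1)"
    by (rule tendsto_eventually)
qed simp

text \<open>Let a and b be the two weighted degrees minus the weight w of the edge. Nonnegative
  curvature reads w/(w + a) + w/(w + b) \<ge> 1, and clearing denominators leaves ab \<le>
  ww.\<close>

lemma admissible_iff:
  "admissible V E w \<longleftrightarrow> positive_weight E w \<and>
    (\<forall>x y. {x, y} \<in> E \<longrightarrow>
      (wdeg E w x - w {x, y}) * (wdeg E w y - w {x, y}) \<le> (w {x, y})\<^sup>2)"
proof -
  have "kappa_LLY V E w x y \<ge> 0 \<longleftrightarrow>
      (wdeg E w x - w {x, y}) * (wdeg E w y - w {x, y}) \<le> (w {x, y})\<^sup>2"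
    if "{x, y} \<in> E" and w: "positive_weight E w" for x y
  proof -
    have pos: "w {a, b} > 0" if "b \<in> nbrs E a" for a b
      using w that by (auto simp: positive_weight_def nbrs_def)
    have "nbrs E x \<noteq> {}" "nbrs E y \<noteq> {}"
      using that by (auto simp: nbrs_def insert_commute)
    then have "wdeg E w x > 0" "wdeg E w y > 0"
      unfolding wdeg_def using finite_nbrs pos by (auto intro!: sum_pos)
    then show ?thesis
      unfolding kappa_LLY_eq[OF that]
      by (simp add: divide_simps) (auto simp: algebra_simps power2_eq_square)
  qed
  then show ?thesis by (auto simp: admissible_def)
qed

end

section \<open>Non-backtracking walks to infinity\<close>

text \<open>\<open>dead_end E x y\<close> holds iff all non-backtracking walks that begin with the step from \<open>x\<close> to \<open>y\<close>
  terminate.\<close>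

inductive dead_end :: "'a set set \<Rightarrow> 'a \<Rightarrow> 'a \<Rightarrow> bool" for E where
  dead_endI: "(\<And>z. z \<in> nbrs E y \<Longrightarrow> z \<noteq> x \<Longrightarrow> dead_end E y z) \<Longrightarrow> dead_end E x y"

text \<open>These are the steps that begin an infinite non-backtracking walk; negating an inductive
  predicate avoids constructing such walks. Adjacency is required separately because
  \<open>dead_end\<close> does not imply it.\<close>

definition escapes :: "'a set set \<Rightarrow> 'a \<Rightarrow> 'a \<Rightarrow> bool" where
  "escapes E x y \<longleftrightarrow> {x, y} \<in> E \<and> \<not> dead_end E x y"

text \<open>Every step in \<open>S\<close> can be continued inside \<open>S\<close> without turning
  back, so rule induction on \<open>dead_end\<close> never reaches a pair in
  \<open>S\<close>.\<close>

lemma not_dead_end_coinduct: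
  assumes "S x y" "\<And>x y. S x y \<Longrightarrow> \<exists>z\<in>nbrs E y. z \<noteq> x \<and> S y z"
  shows "\<not> dead_end E x y"
proof
  assume "dead_end E x y"
  then have "\<not> S x y"
    by induction (use assms(2) in blast)
  with assms(1) show False by blast
qed

lemma escapes_next: "escapes E x y \<Longrightarrow> \<exists>z. z \<noteq> x \<and> escapes E y z"
  using dead_endI[of E y x] by (auto simp: escapes_def nbrs_def)

text \<open>If the step from \<open>u\<close> to \<open>x\<close> were a dead end, so would be all
  its continuations, among them the one to \<open>y\<close>.\<close>

lemma escapes_back:
  assumes "escapes E x y" "{u, x} \<in> E" "u \<noteq> y"
  shows "escapes E u x"
  using assms dead_end.cases[of E u x] by (force simp: escapes_def nbrs_def)

context lf_graph
begin

text \<open>By local finiteness the branch behind \<open>y\<close> is a union of finitely many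
  smaller branches, each finite by induction; only \<open>x\<close> can adjoin it from
  outside.\<close>

lemma dead_end_finite:
  assumes "dead_end E x y"
  shows "\<exists>S. finite S \<and> y \<in> S \<and> (\<forall>u\<in>S. nbrs E u \<subseteq> insert x S)"
  using assms
proof induction
  case (dead_endI y x)
  then obtain S where S: "\<And>z. z \<in> nbrs E y \<Longrightarrow> z \<noteq> x \<Longrightarrow>
      finite (S z) \<and> z \<in> S z \<and> (\<forall>u\<in>S z. nbrs E u \<subseteq> insert y (S z))"
    by metis
  let ?S = "insert y (\<Union>z\<in>nbrs E y - {x}. S z)"
  have "finite ?S" using S finite_nbrs by auto
  moreover have "\<forall>u\<in>?S. nbrs E u \<subseteq> insert x ?S"
  proof
    fix u assume "u \<in> ?S"
    then consider "u = y" | z where "z \<in> nbrs E y" "z \<noteq> x" "u \<in> S z" by auto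
    then show "nbrs E u \<subseteq> insert x ?S"
    proof cases
      case 1 then show ?thesis using S by blast
    next
      case 2 then show ?thesis using S[of z] by blast
    qed
  qed
  ultimately show ?case by blast
qed

lemma finite_if_closed:
  assumes "finite S" "u \<in> S" "u \<in> V" "\<And>v. v \<in> S \<Longrightarrow> nbrs E v \<subseteq> S"
  shows "finite V"
  using graph_connected_closed[OF conn assms(3,2,4)] assms(1) finite_subset by blast

text \<open>A form of Konig's lemma: if every step out of \<open>v\<close> were a dead end, then
  \<open>v\<close> and its finite branches would be closed under neighbours and exhaust
  \<open>V\<close>.\<close>

lemma ex_escapes:
  assumes "infinite V" "v \<in> V"
  shows "\<exists>y. escapes E v y"
proof (rule ccontr)
  assume "\<nexists>y. escapes E v y"
  then have "\<And>y. y \<in> nbrs E v \<Longrightarrow> dead_end E v y" by (auto simp: escapes_def nbrs_def)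
  then have "\<exists>S. finite S \<and> y \<in> S \<and> (\<forall>u\<in>S. nbrs E u \<subseteq> insert v S)" if "y \<in> nbrs E v" for y
    using dead_end_finite that by blast
  then obtain S where S: "\<And>y. y \<in> nbrs E v \<Longrightarrow>
      finite (S y) \<and> y \<in> S y \<and> (\<forall>u\<in>S y. nbrs E u \<subseteq> insert v (S y))"
    by metis
  have "finite V"
  proof (rule finite_if_closed)
    show "finite (insert v (\<Union>y\<in>nbrs E v. S y))" using S finite_nbrs by auto
    show "nbrs E u \<subseteq> insert v (\<Union>y\<in>nbrs E v. S y)" if "u \<in> insert v (\<Union>y\<in>nbrs E v. S y)" for u
      using that S by blast
  qed (use assms in auto)
  with assms(1) show False by simp
qed

text \<open>Running round the cycle for ever, in either sense, never backtracks. This later yields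
  acyclicity when no edge escapes both ways.\<close>

lemma cycle_escapes:
  assumes "graph_cycle E c"
  shows "\<exists>x y. escapes E x y \<and> escapes E y x"
proof -
  define m where "m = length c"
  define f where "f i = c ! (i mod m)" for i
  have m: "m \<ge> 3" and dist: "distinct c" using assms by (auto simp: graph_cycle_def m_def)
  have edge: "{f i, f (Suc i)} \<in> E" for i
  proof (cases "Suc (i mod m) = m")
    case True
    then have "i mod m = length c - 1" "Suc i mod m = 0" by (auto simp: mod_Suc m_def)
    moreover have "c \<noteq> []" using m by (auto simp: m_def)
    ultimately have "f i = last c" "f (Suc i) = hd c"
      by (simp_all add: f_def last_conv_nth hd_conv_nth)
    then show ?thesis using assms by (simp add: graph_cycle_def)
  next
    case False
    then have "Suc (i mod m) < length c"
      using m mod_less_divisor[of m i] unfolding m_def[symmetric] by linarith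
    then show ?thesis
      using assms successively_nth[of "\<lambda>u v. {u, v} \<in> E" c "i mod m"] False
      by (auto simp: graph_cycle_def f_def mod_Suc)
  qed
  \<comment> \<open>Positions two apart differ modulo \<open>m\<close> because \<open>m\<close> is
    at least 3; this rules out turning back.\<close>
  have ne: "f i \<noteq> f (Suc (Suc i))" for i
  proof -
    have "i mod m \<noteq> Suc (Suc i) mod m" using m by (auto simp: mod_Suc)
    moreover have "i mod m < length c" "Suc (Suc i) mod m < length c" 
      using m mod_less_divisor[of m] unfolding m_def[symmetric] by auto
    ultimately show ?thesis using dist by (simp add: f_def nth_eq_iff_index_eq)
  qed
  define S where "S x y \<longleftrightarrow> (\<exists>i. x = f i \<and> y = f (Suc i) \<or> x = f (Suc i) \<and> y = f i)" for x y
  have "\<exists>z\<in>nbrs E y. z \<noteq> x \<and> S y z" if "S x y" for x y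
  proof -
    from that obtain i where "x = f i \<and> y = f (Suc i) \<or> x = f (Suc i) \<and> y = f i"
      by (auto simp: S_def)
    then show ?thesis
    proof
      assume "x = f i \<and> y = f (Suc i)"
      then show ?thesis
        using edge[of "Suc i"] ne[of i] by (auto simp: S_def nbrs_def intro!: bexI[of _ "f (Suc (Suc i))"])
    next
      assume *: "x = f (Suc i) \<and> y = f i"
      \<comment> \<open>The position before \<open>i\<close> on the cycle, shifted by
        \<open>m\<close> so that no truncated subtraction occurs at \<open>i = 0\<close>.\<close>
      define j where "j = i + m - 1"
      have j: "f (Suc j) = f i" "f (Suc (Suc j)) = f (Suc i)"
        using m by (auto simp: j_def f_def mod_Suc)
      have "f j \<in> nbrs E y" "f j \<noteq> x" using * edge[of j] ne[of j] j by (auto simp: nbrs_def insert_commute)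
      moreover have "S y (f j)" unfolding S_def using * j by metis
      ultimately show ?thesis by blast
    qed
  qed
  note co = not_dead_end_coinduct[of S, OF _ this]
  have "S (f 0) (f 1)" "S (f 1) (f 0)" by (auto simp: S_def)
  from this[THEN co] have "escapes E (f 0) (f 1) \<and> escapes E (f 1) (f 0)"
    using edge[of 0] by (auto simp: escapes_def insert_commute)
  then show ?thesis by blast
qed

text \<open>Every step has a unique continuation, so an edge extends in both directions to a walk
  indexed by the integers. A repeated vertex would produce a finite neighbour-closed set and make
  \<open>V\<close> finite.\<close>

lemma two_regular_double_ray:
  assumes "infinite V" and reg: "\<And>u. u \<in> V \<Longrightarrow> \<exists>a b. a \<noteq> b \<and> nbrs E u = {a, b}"
  shows "double_ray V E"
proof -
  have "\<exists>z. z \<noteq> x \<and> nbrs E y = {x, z}" if "{x, y} \<in> E" for x y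
  proof -
    have "y \<in> V" using edgeD[OF that] by blast
    from reg[OF this] obtain a b where "a \<noteq> b" "nbrs E y = {a, b}" by blast
    moreover have "x \<in> nbrs E y" using that by (simp add: nbrs_def insert_commute)
    ultimately show ?thesis by auto
  qed
  then obtain g where g: "\<And>x y. {x, y} \<in> E \<Longrightarrow> g x y \<noteq> x \<and> nbrs E y = {x, g x y}"
    by metis
  obtain x0 y0 where e0: "{x0, y0} \<in> E"
  proof -
    obtain u where "u \<in> V" using conn by (auto simp: graph_connected_def)
    with reg[of u] that show thesis by (fastforce simp: nbrs_def)
  qed
  \<comment> \<open>The state is a pair of consecutive vertices; the first component of
    \<open>s x y i\<close> is vertex number \<open>i\<close> of the run.\<close>
  define s where "s x y i = ((\<lambda>(x, y). (y, g x y)) ^^ i) (x, y)" for x y i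
  have s0: "s x y 0 = (x, y)" and sS: "s x y (Suc i) = (snd (s x y i), g (fst (s x y i)) (snd (s x y i)))"
    for x y i by (simp_all add: s_def case_prod_beta)
  have sE: "{fst (s x y i), snd (s x y i)} \<in> E" if "{x, y} \<in> E" for x y i
  proof (induction i)
    case (Suc i)
    then have "g (fst (s x y i)) (snd (s x y i)) \<in> nbrs E (snd (s x y i))" using g by blast
    then show ?case by (simp add: sS nbrs_def)
  qed (use that in \<open>simp add: s0\<close>)
  have sN: "nbrs E (fst (s x y (Suc i))) = {fst (s x y i), fst (s x y (Suc (Suc i)))} \<and>
      fst (s x y i) \<noteq> fst (s x y (Suc (Suc i)))" if "{x, y} \<in> E" for x y i
    using g[OF sE[OF that, of i]] by (auto simp: sS)
  \<comment> \<open>The forward run has \<open>x0\<close>, \<open>y0\<close> at positions 0 and 1,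
    the backward one \<open>y0\<close>, \<open>x0\<close> at positions 1 and 0. Hence the index
    \<open>1 - i\<close>; the runs agree on this overlap.\<close>
  define v :: "int \<Rightarrow> 'a" where
    "v i = (if i \<ge> 0 then fst (s x0 y0 (nat i)) else fst (s y0 x0 (nat (1 - i))))" for i
  have vn: "v (int i) = fst (s x0 y0 i)" "v (1 - int i) = fst (s y0 x0 i)" for i
  proof -
    show "v (int i) = fst (s x0 y0 i)" by (simp add: v_def)
    consider "i = 0" | "i = 1" | "i \<ge> 2" by linarith
    then show "v (1 - int i) = fst (s y0 x0 i)"
      by cases (simp_all add: v_def s0 sS[of _ _ 0, simplified])
  qed
  have e0': "{y0, x0} \<in> E" using e0 by (simp add: insert_commute)
  have vN: "nbrs E (v i) = {v (i - 1), v (i + 1)} \<and> v (i - 1) \<noteq> v (i + 1)" for i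
  proof (cases "i \<ge> 1")
    case True
    define n where "n = nat (i - 1)"
    have n: "i = int (Suc n)" using True by (simp add: n_def)
    have "i - 1 = int n" "i + 1 = int (Suc (Suc n))" using n by auto
    then show ?thesis using sN[OF e0, of n] n by (simp only: vn) simp
  next
    case False
    define n where "n = nat (- i)"
    have n: "i = 1 - int (Suc n)" "i - 1 = 1 - int (Suc (Suc n))" "i + 1 = 1 - int n"
      using False by (auto simp: n_def)
    then show ?thesis using sN[OF e0', of n] by (simp only: vn n) auto
  qed
  have vV: "v i \<in> V" for i using vN[of i] nbrsD by blast
  have vE: "{v i, v (i + 1)} \<in> E" for i using vN[of i] by (auto simp: nbrs_def)
  have Vr: "V \<subseteq> range v"
    by (rule graph_connected_closed[OF conn vV[of 0]]) (use vN in auto)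
  have "inj v"
  proof (rule ccontr)
    assume "\<not> inj v"
    then obtain i0 j0 where "v i0 = v j0" "i0 < j0" by (metis injI linorder_neqE)
    then have ex: "\<exists>k i. v i = v (i + int k) \<and> 0 < k"
      by (intro exI[of _ "nat (j0 - i0)"] exI[of _ i0]) simp
    \<comment> \<open>The shortest distance between two positions that carry the same
      vertex.\<close>
    define k where "k = (LEAST k. \<exists>i. v i = v (i + int k) \<and> 0 < k)"
    have "\<exists>i. v i = v (i + int k) \<and> 0 < k" unfolding k_def by (rule LeastI_ex[OF ex])
    then obtain i where i: "v i = v (i + int k)" "0 < k" by blast
    have least: "k \<le> l" if "v a = v (a + int l)" "0 < l" for a l
      unfolding k_def using that by (intro Least_le) blast
    have k2: "k > 2"
    proof -
      have "k \<noteq> 1" using i edgeD[OF vE[of i]] by auto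
      moreover have "k \<noteq> 2" using i vN[of "i + 1"] by (auto simp: algebra_simps)
      ultimately show ?thesis using i by linarith
    qed
    \<comment> \<open>Equality would be a repetition at the smaller positive distance
      \<open>k - 2\<close>. So these are the two neighbours of \<open>v i\<close>, and the window of
      length \<open>k\<close> closes up.\<close>
    have "v (i + 1) \<noteq> v (i + int k - 1)"
    proof
      assume "v (i + 1) = v (i + int k - 1)"
      then have "v (i + 1) = v ((i + 1) + int (k - 2))" using k2 by (simp add: of_nat_diff algebra_simps)
      from least[OF this] k2 show False by simp
    qed
    moreover have "v (i + 1) \<in> nbrs E (v i)" "v (i + int k - 1) \<in> nbrs E (v i)"
      using vN[of i] vN[of "i + int k"] i by auto
    ultimately have Ni: "nbrs E (v i) \<subseteq> {v (i + 1), v (i + int k - 1)}"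
      using vN[of i] by auto
    let ?S = "v ` {i..<i + int k}"
    have "finite V"
    proof (rule finite_if_closed)
      show "finite ?S" by simp
      show vi: "v i \<in> ?S" using i(2) by (intro imageI) simp
      show "v i \<in> V" by (rule vV)
      fix u assume "u \<in> ?S"
      then obtain j where j: "u = v j" "i \<le> j" "j < i + int k" by auto
      show "nbrs E u \<subseteq> ?S"
      proof (cases "j = i")
        case True
        have "v (i + 1) \<in> ?S" "v (i + int k - 1) \<in> ?S" using k2 by (auto intro: imageI)
        with Ni j True show ?thesis by auto
      next
        case False
        have "v (j + 1) \<in> ?S"
        proof (cases "j + 1 = i + int k")
          case True
          then have "v (j + 1) = v i" using i by simp
          with vi show ?thesis by simp
        qed (use j in auto)
        moreover have "v (j - 1) \<in> ?S" using j False by auto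
        ultimately show ?thesis using vN[of j] j by auto
      qed
    qed
    with assms(1) show False by simp
  qed
  moreover have "V = range v" using Vr vV by blast
  moreover have "E = range (\<lambda>i. {v i, v (i + 1)})"
  proof
    show "E \<subseteq> range (\<lambda>i. {v i, v (i + 1)})"
    proof
      fix e assume "e \<in> E"
      then obtain x y where e: "e = {x, y}" "{x, y} \<in> E" by (rule edgeE)
      then obtain i where i: "x = v i" using edgeD Vr by blast
      then have "y = v (i - 1) \<or> y = v (i + 1)" using e vN[of i] by (auto simp: nbrs_def)
      then show "e \<in> range (\<lambda>i. {v i, v (i + 1)})"
      proof
        assume "y = v (i - 1)"
        then have "e = {v (i - 1), v (i - 1 + 1)}" using e i by auto
        then show ?thesis by blast
      qed (use e i in blast)
    qed
  qed (use vE in auto)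
  ultimately show ?thesis unfolding double_ray_def by blast
qed

end

section \<open>Bounded log-concave weights\<close>

lemma wdeg_remove:
  assumes "finite (nbrs E x)" "y \<in> nbrs E x"
  shows "wdeg E w x - w {x, y} = (\<Sum>z\<in>nbrs E x - {y}. w {x, z})"
  using sum.remove[OF assms, of "\<lambda>z. w {x, z}"] by (simp add: wdeg_def)

text \<open>Captures admissible weights of finite distortion: by \<open>admissible_iff\<close>, the
  last inequality is nonnegative curvature, and the girth is present only through it.\<close>

locale log_concave_weight = lf_graph +
  fixes w :: "'a set \<Rightarrow> real" and c C :: real
  assumes c_pos: "c > 0"
    and w_ge: "e \<in> E \<Longrightarrow> c \<le> w e"
    and w_le: "e \<in> E \<Longrightarrow> w e \<le> C"
    and log_concave: "{x, y} \<in> E \<Longrightarrow>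
      (wdeg E w x - w {x, y}) * (wdeg E w y - w {x, y}) \<le> (w {x, y})\<^sup>2"
begin

lemma w_pos: "e \<in> E \<Longrightarrow> w e > 0"
  using c_pos w_ge by fastforce

lemma wdeg_ge_pair:
  assumes "{x, y} \<in> E" "{y, z} \<in> E" "z \<noteq> x"
  shows "w {y, z} \<le> wdeg E w y - w {x, y}"
proof -
  have x: "x \<in> nbrs E y" using assms by (simp add: nbrs_def insert_commute)
  have "w {y, z} \<le> (\<Sum>z\<in>nbrs E y - {x}. w {y, z})"
    using assms finite_nbrs w_pos
    by (intro member_le_sum) (auto simp: nbrs_def intro: less_imp_le)
  then show ?thesis
    using wdeg_remove[OF finite_nbrs x, of w] by (simp add: insert_commute)
qed

text \<open>A third neighbour of \<open>y\<close> contributes at least \<open>c\<close>. This fixed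
  surplus is the cost of branching.\<close>

lemma wdeg_ge_triple:
  assumes "{x, y} \<in> E" "{y, z} \<in> E" "z \<noteq> x" "nbrs E y \<noteq> {x, z}"
  shows "w {y, z} + c \<le> wdeg E w y - w {x, y}"
proof -
  have x: "x \<in> nbrs E y" and z: "z \<in> nbrs E y - {x}"
    using assms by (auto simp: nbrs_def insert_commute)
  obtain a where a: "a \<in> nbrs E y - {x} - {z}" using x z assms(4) by blast
  have "c \<le> w {y, a}" using a w_ge by (auto simp: nbrs_def)
  also have "\<dots> \<le> (\<Sum>z\<in>nbrs E y - {x} - {z}. w {y, z})"
    using a finite_nbrs w_pos
    by (intro member_le_sum) (auto simp: nbrs_def intro: less_imp_le)
  also have "\<dots> = (\<Sum>z\<in>nbrs E y - {x}. w {y, z}) - w {y, z}"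
    using sum.remove[OF _ z, of "\<lambda>z. w {y, z}"] finite_nbrs by simp
  finally show ?thesis
    using wdeg_remove[OF finite_nbrs x, of w] by (simp add: insert_commute)
qed

text \<open>Along a non-backtracking walk the weights are log-concave; since they are bounded away from \<open>0\<close>,
  they cannot decrease on a walk that never ends.\<close>

lemma escapes_weight_mono:
  assumes "escapes E x y" "escapes E y z" "z \<noteq> x"
  shows "w {x, y} \<le> w {y, z}"
proof (rule ccontr)
  assume less: "\<not> w {x, y} \<le> w {y, z}"
  define q where "q = w {y, z} / w {x, y}"
  have xy: "{x, y} \<in> E" and yz: "{y, z} \<in> E" using assms by (auto simp: escapes_def)
  have q: "0 < q" "q < 1"
    using less w_pos[OF xy] w_pos[OF yz] by (auto simp: q_def)
  \<comment> \<open>Log-concavity passes the factor \<open>q\<close> from each pair of consecutive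
    edges to the next, so weights decay geometrically along an endless walk, against the lower bound
    \<open>c\<close>.\<close>
  have "\<exists>a b d. escapes E a b \<and> escapes E b d \<and> d \<noteq> a \<and> w {b, d} \<le> q * w {a, b} \<and> w {b, d} \<le> q ^ n * C"
    for n
  proof (induction n)
    case 0
    show ?case
      using assms w_le[OF yz] w_pos[OF xy]
      by (intro exI[of _ x] exI[of _ y] exI[of _ z]) (simp add: q_def)
  next
    case (Suc n)
    then obtain a b d where *: "escapes E a b" "escapes E b d" "d \<noteq> a"
      "w {b, d} \<le> q * w {a, b}" "w {b, d} \<le> q ^ n * C" by blast
    obtain e where e: "e \<noteq> b" "escapes E d e" using escapes_next[OF *(2)] by blast
    have E: "{a, b} \<in> E" "{b, d} \<in> E" "{d, e} \<in> E" using * e by (auto simp: escapes_def)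
    note p = E[THEN w_pos]
    have "w {a, b} \<le> wdeg E w b - w {b, d}"
      using wdeg_ge_pair[of d b a] E *(3) by (simp add: insert_commute)
    moreover have "w {d, e} \<le> wdeg E w d - w {b, d}"
      using wdeg_ge_pair[of b d e] E e by simp
    ultimately have "w {a, b} * w {d, e} \<le> (wdeg E w b - w {b, d}) * (wdeg E w d - w {b, d})"
      using p by (intro mult_mono) auto
    also have "\<dots> \<le> (w {b, d})\<^sup>2" by (rule log_concave[OF E(2)])
    also have "\<dots> \<le> q * w {a, b} * w {b, d}"
      using *(4) p by (simp add: power2_eq_square)
    finally have "w {a, b} * w {d, e} \<le> w {a, b} * (q * w {b, d})" by (simp add: mult_ac)
    then have le: "w {d, e} \<le> q * w {b, d}" using p by simp
    also have "\<dots> \<le> q * (q ^ n * C)" using *(5) q by simp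
    finally show ?case using *(2) e le by (intro exI[of _ b] exI[of _ d] exI[of _ e]) simp
  qed
  then have "\<exists>b d. {b, d} \<in> E \<and> w {b, d} \<le> q ^ n * C" for n
    by (meson escapes_def)
  then have ge: "c \<le> q ^ n * C" for n using w_ge by (meson order_trans)
  have "(\<lambda>n. q ^ n * C) \<longlonglongrightarrow> 0 * C"
    using q by (intro tendsto_mult LIMSEQ_realpow_zero tendsto_const) auto
  then have "c \<le> 0 * C" by (rule LIMSEQ_le_const) (use ge in auto)
  with c_pos show False by simp
qed

text \<open>By monotonicity the edges continuing at both ends weigh at least
  \<open>w {x, y}\<close>. A third neighbour of \<open>y\<close> would push the product in
  \<open>log_concave\<close> beyond the square, by at least \<open>c\<close> times
  \<open>w {x, y}\<close>.\<close>

lemma two_sided_degree_2: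
  assumes "escapes E x y" "escapes E y x"
  shows "\<exists>z. z \<noteq> x \<and> nbrs E y = {x, z} \<and> escapes E y z \<and> escapes E z y"
proof -
  obtain z where z: "z \<noteq> x" "escapes E y z" using escapes_next[OF assms(1)] by blast
  obtain u where u: "u \<noteq> y" "escapes E x u" using escapes_next[OF assms(2)] by blast
  have E: "{x, y} \<in> E" "{y, z} \<in> E" "{x, u} \<in> E" using assms z u by (auto simp: escapes_def)
  have wz: "w {x, y} \<le> w {y, z}" using escapes_weight_mono assms z by blast
  have wu: "w {x, y} \<le> w {x, u}" using escapes_weight_mono[OF assms(2) u(2,1)] by (simp add: insert_commute)
  have "nbrs E y = {x, z}"
  proof (rule ccontr)
    assume "nbrs E y \<noteq> {x, z}"
    then have "w {y, z} + c \<le> wdeg E w y - w {x, y}" using wdeg_ge_triple E z by blast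
    moreover have "w {x, u} \<le> wdeg E w x - w {x, y}"
      using wdeg_ge_pair[of y x u] E u by (simp add: insert_commute)
    ultimately have "w {x, y} * (w {x, y} + c) \<le> (wdeg E w x - w {x, y}) * (wdeg E w y - w {x, y})"
      using wz wu w_pos[OF E(1)] c_pos by (intro mult_mono) auto
    also have "\<dots> \<le> w {x, y} * w {x, y}"
      using log_concave[OF E(1)] by (simp add: power2_eq_square)
    finally show False using mult_pos_pos[OF w_pos[OF E(1)] c_pos] by (simp add: algebra_simps)
  qed
  moreover have "escapes E z y"
    using escapes_back[of E y x z] assms z E by (auto simp: insert_commute)
  ultimately show ?thesis using z by blast
qed

text \<open>Being on a two-sided edge passes to all neighbours by \<open>two_sided_degree_2\<close>,
  so connectedness spreads it over \<open>V\<close>.\<close>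

lemma double_ray_if_two_sided:
  assumes "infinite V" "escapes E x y" "escapes E y x"
  shows "double_ray V E"
proof -
  have two: "\<exists>a b. a \<noteq> b \<and> nbrs E u = {a, b} \<and> escapes E u a \<and> escapes E a u \<and> escapes E u b \<and> escapes E b u"
    if "escapes E u a" "escapes E a u" for u a
    using two_sided_degree_2[of a u] that by blast
  let ?S = "{u. \<exists>a. escapes E u a \<and> escapes E a u}"
  have "V \<subseteq> ?S"
  proof (rule graph_connected_closed[OF conn])
    show "x \<in> V" using assms edgeD by (auto simp: escapes_def)
    show "x \<in> ?S" using assms by blast
    fix u assume "u \<in> ?S"
    then obtain a where "escapes E u a" "escapes E a u" by blast
    from two[OF this] show "nbrs E u \<subseteq> ?S" by auto
  qed
  then show ?thesis using two by (intro two_regular_double_ray assms(1)) blast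
qed

end

text \<open>In a one-ended tree every vertex has exactly one escaping neighbour, its successor on the way to
  the end, and every edge joins a vertex to its successor.\<close>

locale one_ended = lf_graph +
  assumes inf: "infinite V"
    and one_sided: "escapes E x y \<Longrightarrow> \<not> escapes E y x"
begin

definition succ :: "'a \<Rightarrow> 'a" where
  "succ v = (SOME y. escapes E v y)"

lemma escapes_succ: "v \<in> V \<Longrightarrow> escapes E v (succ v)"
  unfolding succ_def by (rule someI_ex) (rule ex_escapes[OF inf])

lemma succ_edge: "v \<in> V \<Longrightarrow> {v, succ v} \<in> E"
  using escapes_succ by (auto simp: escapes_def)

lemma succ_in_V: "v \<in> V \<Longrightarrow> succ v \<in> V"
  using succ_edge edgeD by blast

lemma iter_in_V: "v \<in> V \<Longrightarrow> (succ ^^ i) v \<in> V"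
  by (induction i) (auto intro: succ_in_V)

text \<open>Otherwise the edge could be put in front of the escaping steps out of both its ends, and
  would itself escape both ways.\<close>

lemma edge_succ:
  assumes "{x, y} \<in> E" shows "y = succ x \<or> x = succ y"
proof (rule ccontr)
  assume "\<not> ?thesis"
  then have "escapes E y x" "escapes E x y"
    using escapes_back[OF escapes_succ, of x y] escapes_back[OF escapes_succ, of y x]
      assms edgeD[OF assms] by (auto simp: insert_commute)
  then show False using one_sided by blast
qed

lemma succ_succ: "v \<in> V \<Longrightarrow> succ (succ v) \<noteq> v"
  using one_sided escapes_succ succ_in_V by metis

lemma dead_end_succ: "v \<in> V \<Longrightarrow> dead_end E (succ v) v"
  using one_sided[OF escapes_succ, of v] succ_edge[of v] by (simp add: escapes_def insert_commute)

text \<open>If the orbit returned to \<open>v\<close>, traversing it backwards would be an endless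
  non-backtracking walk beginning with the step from \<open>succ v\<close> to \<open>v\<close>,
  which is a dead end.\<close>

lemma no_period:
  assumes v: "v \<in> V" and p: "p > 0"
  shows "(succ ^^ p) v \<noteq> v"
proof
  assume per: "(succ ^^ p) v = v"
  define S where "S x y \<longleftrightarrow> (\<exists>i. x = (succ ^^ Suc i) v \<and> y = (succ ^^ i) v)" for x y
  have "\<not> dead_end E (succ v) v"
  proof (rule not_dead_end_coinduct)
    show "S (succ v) v" unfolding S_def by (rule exI[of _ 0]) simp
    fix x y assume "S x y"
    then obtain i where i: "x = (succ ^^ Suc i) v" "y = (succ ^^ i) v" by (auto simp: S_def)
    \<comment> \<open>The predecessor of \<open>y\<close> on the periodic orbit; adding the period
      makes the index valid also for \<open>i = 0\<close>.\<close>
    let ?z = "(succ ^^ (i + p - 1)) v"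
    have z: "succ ?z = (succ ^^ (i + p)) v" using p by (cases p) auto
    also have "\<dots> = y" using per i by (simp add: funpow_add)
    finally have z: "succ ?z = y" .
    have "?z \<in> nbrs E y"
      using succ_edge[OF iter_in_V[OF v, of "i + p - 1"]] z by (simp add: nbrs_def insert_commute)
    moreover have "?z \<noteq> x"
      using z i succ_succ[OF iter_in_V[OF v, of i]] by auto
    moreover have "S y ?z" unfolding S_def
      using z by (intro exI[of _ "i + p - 1"]) simp
    ultimately show "\<exists>z\<in>nbrs E y. z \<noteq> x \<and> S y z" by blast
  qed
  then show False using dead_end_succ[OF v] by simp
qed

lemma iter_inj: "v \<in> V \<Longrightarrow> inj (\<lambda>i. (succ ^^ i) v)"
proof (rule injI, rule ccontr)
  fix i j assume v: "v \<in> V" and eq: "(succ ^^ i) v = (succ ^^ j) v" and "i \<noteq> j"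
  have "\<not> a < b" if "(succ ^^ a) v = (succ ^^ b) v" for a b
  proof
    assume "a < b"
    have "(succ ^^ (b - a)) ((succ ^^ a) v) = (succ ^^ (b - a + a)) v"
      by (simp only: funpow_add comp_apply)
    also have "\<dots> = (succ ^^ a) v" using \<open>a < b\<close> that by simp
    finally have "(succ ^^ (b - a)) ((succ ^^ a) v) = (succ ^^ a) v" .
    then show False using no_period[OF iter_in_V[OF v]] \<open>a < b\<close> by simp
  qed
  from this[OF eq] this[OF eq[symmetric]] \<open>i \<noteq> j\<close> show False by linarith
qed

lemma acyclic: "\<not> graph_cycle E c"
  using cycle_escapes one_sided by blast

text \<open>Here \<open>v\<close> becomes the vertex of attachment: by \<open>thin\<close>,
  everything after it on the successor ray has degree 2.\<close>

lemma finite_tree_with_ray_if_thin_ray: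
  assumes v: "v \<in> V" and thin: "\<And>i. nbrs E ((succ ^^ Suc i) v) = {(succ ^^ i) v, (succ ^^ Suc (Suc i)) v}"
  shows "finite_tree_with_ray V E"
proof -
  define r where "r i = (succ ^^ Suc i) v" for i
  \<comment> \<open>The vertices whose successor orbit passes through \<open>v\<close>; following
    \<open>succ\<close> makes this a tree rooted at \<open>v\<close>.\<close>
  define K where "K = {u \<in> V. \<exists>j. (succ ^^ j) u = v}"
  define EK where "EK = {{u, succ u} |u. u \<in> K \<and> u \<noteq> v}"
  have rV: "r i \<in> V" for i unfolding r_def by (rule iter_in_V[OF v])
  have "inj r" using injD[OF iter_inj[OF v]] unfolding r_def by (blast intro: injI)
  have vK: "v \<in> K" using v by (auto simp: K_def intro: exI[of _ 0])
  have disj: "K \<inter> range r = {}"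
  proof (rule ccontr)
    assume "K \<inter> range r \<noteq> {}"
    then obtain i j where "(succ ^^ j) ((succ ^^ Suc i) v) = v" by (auto simp: K_def r_def)
    then have "(succ ^^ (j + Suc i)) v = v" by (simp only: funpow_add comp_apply)
    then show False using no_period[OF v, of "j + Suc i"] by simp
  qed
  have succK: "succ u \<in> K" if "u \<in> K" "u \<noteq> v" for u
  proof -
    obtain j where j: "u \<in> V" "(succ ^^ j) u = v" using \<open>u \<in> K\<close> by (auto simp: K_def)
    then obtain l where "j = Suc l" using \<open>u \<noteq> v\<close> by (cases j) auto
    with j have "(succ ^^ l) (succ u) = v" by (simp add: funpow_swap1)
    then show ?thesis using j(1) succ_in_V unfolding K_def by blast
  qed
  have succ_memK: "u \<in> K" if "succ u \<in> K" "u \<in> V" for u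
  proof -
    from that obtain j where "(succ ^^ j) (succ u) = v" by (auto simp: K_def)
    then have "(succ ^^ Suc j) u = v" by (simp add: funpow_swap1)
    with that(2) show ?thesis unfolding K_def by blast
  qed
  have succ_r: "succ (r i) = r (Suc i)" for i by (simp add: r_def)
  have succ_v: "succ v = r 0" by (simp add: r_def)
  have nbr_K: "y \<in> K \<or> u = v \<and> y = r 0" if "u \<in> K" "y \<in> nbrs E u" for u y
  proof -
    have uy: "{u, y} \<in> E" using that by (simp add: nbrs_def)
    from edge_succ[OF uy] show ?thesis
    proof
      assume "y = succ u" then show ?thesis using succK that succ_v by auto
    next
      assume "u = succ y" then show ?thesis using succ_memK[of y] that edgeD[OF uy] by auto
    qed
  qed
  have nbrs_r0: "nbrs E (r 0) = {v, r 1}" using thin[of 0] by (simp add: r_def)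
  have nbrs_rS: "nbrs E (r (Suc i)) = {r i, r (Suc (Suc i))}" for i using thin[of "Suc i"] by (simp add: r_def)
  have V: "V = K \<union> range r"
  proof
    show "V \<subseteq> K \<union> range r"
    proof (rule graph_connected_closed[OF conn v])
      show "v \<in> K \<union> range r" using vK by simp
      fix u assume "u \<in> K \<union> range r"
      then consider "u \<in> K" | "u = r 0" | i where "u = r (Suc i)" by (metis UnE rangeE not0_implies_Suc)
      then show "nbrs E u \<subseteq> K \<union> range r"
        by cases (use nbr_K vK nbrs_r0 nbrs_rS in auto)
    qed
  qed (use rV in \<open>auto simp: K_def\<close>)
  \<comment> \<open>The branch at \<open>v\<close> seen from \<open>r 0\<close> is a dead end, hence
    finite. Induction on the number of successor steps to \<open>v\<close> keeps \<open>K\<close>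
    inside it, since \<open>K\<close> misses \<open>r 0\<close>.\<close>
  have "finite K"
  proof -
    have "dead_end E (r 0) v" using dead_end_succ[OF v] succ_v by simp
    from dead_end_finite[OF this]
    obtain S where S: "finite S" "v \<in> S" "\<And>u. u \<in> S \<Longrightarrow> nbrs E u \<subseteq> insert (r 0) S"
      by blast
    have "u \<in> S" if "u \<in> V" "(succ ^^ j) u = v" for u j
      using that
    proof (induction j arbitrary: u)
      case (Suc j)
      then have "succ u \<in> S" using Suc.IH[OF succ_in_V] by (simp add: funpow_swap1)
      moreover have "u \<in> nbrs E (succ u)" using succ_edge[OF Suc(2)] by (simp add: nbrs_def insert_commute)
      moreover have "u \<in> K" using Suc(2,3) unfolding K_def by blast
      then have "u \<noteq> r 0" using disj by blast
      ultimately show ?case using S(3) by blast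
    qed (use S in simp)
    then have "K \<subseteq> S" by (auto simp: K_def)
    then show ?thesis using S(1) finite_subset by blast
  qed
  have simpleK: "simple_graph K EK"
    unfolding simple_graph_def EK_def using succK succ_edge edgeD by (fastforce simp: K_def)
  moreover have "graph_connected K EK"
  proof (rule graph_connectedI[OF simpleK vK])
    fix S assume vS: "v \<in> S" and S: "\<And>u. u \<in> S \<Longrightarrow> nbrs EK u \<subseteq> S"
    have "u \<in> S" if "u \<in> V" "(succ ^^ j) u = v" for u j
      using that
    proof (induction j arbitrary: u)
      case (Suc j)
      have "succ u \<in> S" using Suc.IH[OF succ_in_V] Suc.prems by (simp add: funpow_swap1)
      moreover have "u \<in> K" using Suc.prems unfolding K_def by blast
      then have "u \<noteq> v \<Longrightarrow> u \<in> nbrs EK (succ u)"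
        by (auto simp: nbrs_def EK_def insert_commute)
      ultimately show ?case using S vS by blast
    qed (use vS in simp)
    then show "K \<subseteq> S" by (auto simp: K_def)
  qed
  moreover have EKE: "EK \<subseteq> E" using succ_edge by (auto simp: EK_def K_def)
  moreover have "\<not> graph_cycle EK c" for c
  proof
    assume "graph_cycle EK c"
    then have "graph_cycle E c"
      using EKE unfolding graph_cycle_def by (auto elim!: successively_mono)
    then show False using acyclic by blast
  qed
  moreover have "E = EK \<union> range (\<lambda>i. {r i, r (Suc i)}) \<union> {{v, r 0}}"
  proof
    show "E \<subseteq> EK \<union> range (\<lambda>i. {r i, r (Suc i)}) \<union> {{v, r 0}}"
    proof
      fix e assume "e \<in> E"
      then obtain x y where e: "e = {x, y}" "{x, y} \<in> E" by (rule edgeE)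
      then obtain u where u: "e = {u, succ u}" "u \<in> V" using edge_succ edgeD by (metis insert_commute)
      then consider "u = v" | "u \<in> K" "u \<noteq> v" | i where "u = r i" using V by blast
      then show "e \<in> EK \<union> range (\<lambda>i. {r i, r (Suc i)}) \<union> {{v, r 0}}"
        by cases (use u succ_v succ_r in \<open>auto simp: EK_def\<close>)
    qed
    show "EK \<union> range (\<lambda>i. {r i, r (Suc i)}) \<union> {{v, r 0}} \<subseteq> E"
      using EKE succ_edge[OF rV] succ_edge[OF v] by (auto simp: succ_r succ_v)
  qed
  ultimately show ?thesis
    unfolding finite_tree_with_ray_def tree_def
    using \<open>finite K\<close> vK \<open>inj r\<close> disj V by blast
qed

end

section \<open>Growth of the weight towards the end\<close>

locale one_ended_log_concave = one_ended + log_concave_weight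
begin

text \<open>Weights along a successor ray are nondecreasing and bounded, so their increments tend to
  0, while a branching vertex forces an increment of at least \<open>c\<close>. Beyond some
  \<open>N\<close> the ray is therefore thin.\<close>

lemma finite_tree_with_ray: "finite_tree_with_ray V E"
proof -
  obtain v where v: "v \<in> V" using conn by (auto simp: graph_connected_def)
  define a where "a i = (succ ^^ i) v" for i
  have aV: "a i \<in> V" for i unfolding a_def by (rule iter_in_V[OF v])
  have aS: "a (Suc i) = succ (a i)" for i by (simp add: a_def)
  have aE: "{a i, a (Suc i)} \<in> E" for i unfolding aS by (rule succ_edge[OF aV])
  have aT: "escapes E (a i) (a (Suc i))" for i unfolding aS by (rule escapes_succ[OF aV])
  have ne: "a (Suc (Suc i)) \<noteq> a i" for i unfolding aS by (rule succ_succ[OF aV])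
  define b where "b i = w {a i, a (Suc i)}" for i
  have b_mono: "b i \<le> b (Suc i)" for i
    unfolding b_def using escapes_weight_mono[OF aT aT ne] .
  have b_pos: "b i > 0" and b_le: "b i \<le> C" for i unfolding b_def using w_pos w_le aE by auto
  \<comment> \<open>Log-concavity on the edge after the branching vertex gives
    \<open>(b i + c) * b (Suc (Suc i)) \<le> b (Suc i) * b (Suc i)\<close>; monotonicity allows
    cancelling \<open>b (Suc i)\<close>.\<close>
  have jump: "b (Suc i) \<ge> b i + c"
    if "nbrs E (a (Suc i)) \<noteq> {a i, a (Suc (Suc i))}" for i
  proof -
    have "b i + c \<le> wdeg E w (a (Suc i)) - b (Suc i)"
      using wdeg_ge_triple[of "a (Suc (Suc i))" "a (Suc i)" "a i"] aE[of i] aE[of "Suc i"] ne[of i] that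
      by (simp add: b_def insert_commute)
    moreover have "b (Suc (Suc i)) \<le> wdeg E w (a (Suc (Suc i))) - b (Suc i)"
      using wdeg_ge_pair[OF aE[of "Suc i"] aE ne] by (simp add: b_def)
    ultimately have "(b i + c) * b (Suc i) \<le>
        (wdeg E w (a (Suc i)) - b (Suc i)) * (wdeg E w (a (Suc (Suc i))) - b (Suc i))"
      using b_pos[of i] b_pos[of "Suc i"] b_mono[of "Suc i"] c_pos by (intro mult_mono) auto
    also have "\<dots> \<le> b (Suc i) * b (Suc i)"
      using log_concave[OF aE[of "Suc i"]] by (simp add: b_def power2_eq_square)
    finally show ?thesis using b_pos[of "Suc i"] by simp
  qed
  have "incseq b" by (intro incseq_SucI b_mono)
  moreover have "\<forall>i. b i \<le> C" using b_le by simp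
  ultimately obtain L where "b \<longlonglongrightarrow> L" by (rule incseq_convergent)
  then have "(\<lambda>i. b (Suc i) - b i) \<longlonglongrightarrow> L - L" by (intro tendsto_diff LIMSEQ_Suc)
  then have "eventually (\<lambda>i. b (Suc i) - b i < c) sequentially"
    using c_pos by (intro order_tendstoD(2)) auto
  then obtain N where N: "\<And>i. i \<ge> N \<Longrightarrow> b (Suc i) - b i < c"
    by (auto simp: eventually_sequentially)
  have "nbrs E (a (Suc (i + N))) = {a (i + N), a (Suc (Suc (i + N)))}" for i
  proof (rule ccontr)
    assume "\<not> ?thesis"
    then have "b (Suc (i + N)) \<ge> b (i + N) + c" by (rule jump)
    with N[of "i + N"] show False by simp
  qed
  moreover have "(succ ^^ j) (a N) = a (j + N)" for j by (simp add: a_def funpow_add)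
  ultimately show ?thesis
    by (intro finite_tree_with_ray_if_thin_ray[OF aV[of N]]) (simp only: add_Suc)
qed

end

lemma (in log_concave_weight) double_ray_or_finite_tree_with_ray:
  assumes "infinite V"
  shows "double_ray V E \<or> finite_tree_with_ray V E"
proof (cases "\<exists>x y. escapes E x y \<and> escapes E y x")
  case True
  then show ?thesis using double_ray_if_two_sided assms by blast
next
  case False
  then interpret one_ended_log_concave V E w c C
    using assms by unfold_locales auto
  show ?thesis using finite_tree_with_ray ..
qed

section \<open>Weights on finite trees\<close>

lemma tree_finite_lf_graph:
  assumes "tree V E" "finite V"
  shows "lf_graph V E"
proof
  show s: "simple_graph V E" and "graph_connected V E" using assms by (auto simp: tree_def)
  have "nbrs E x \<subseteq> V" for x
    using s by (force simp: nbrs_def simple_graph_def doubleton_eq_iff)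
  then show "locally_finite V E"
    using assms(2) finite_subset unfolding locally_finite_def by blast
qed

text \<open>The end of a longest path from \<open>k\<close> is a leaf.\<close>

lemma tree_leaf:
  assumes T: "tree V E" and fin: "finite V" and k: "k \<in> V" "V \<noteq> {k}"
  obtains l u where "l \<in> V" "l \<noteq> k" "nbrs E l = {u}"
proof -
  interpret lf_graph V E by (rule tree_finite_lf_graph[OF T fin])
  let ?P = "\<lambda>p. p \<noteq> [] \<and> hd p = k \<and> distinct p \<and> set p \<subseteq> V \<and> successively (\<lambda>u v. {u, v} \<in> E) p"
  have Pk: "?P [k]" using k by simp
  have le: "\<forall>p. ?P p \<longrightarrow> length p < Suc (card V)"
    using card_mono[OF fin] by (metis distinct_card less_Suc_eq_le)
  have "\<exists>p. ?P p \<and> (\<forall>q. ?P q \<longrightarrow> length q \<le> length p)"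
    by (rule ex_has_greatest_nat[of ?P, OF Pk le])
  then obtain p where p: "?P p" and max: "\<And>q. ?P q \<Longrightarrow> length q \<le> length p" by blast
  define l where "l = last p"
  have lV: "l \<in> V" using p by (auto simp: l_def)
  have nb: "z \<in> set p" if "z \<in> nbrs E l" for z
  proof (rule ccontr)
    assume "z \<notin> set p"
    then have "?P (p @ [z])"
      using p that nbrsD[OF that] by (simp add: successively_append_iff nbrs_def l_def)
    from max[OF this] show False by simp
  qed
  have "p = butlast p @ [l]" using p by (simp add: l_def)
  then obtain b where b: "p = b @ [l]" ..
  have "b \<noteq> []"
  proof
    assume "b = []"
    then have "p = [k]" "l = k" using p b by auto
    then have "nbrs E k \<subseteq> {k}" using nb by auto
    then have "V \<subseteq> {k}" by (intro graph_connected_closed[OF conn k(1)]) auto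
    with k show False by blast
  qed
  then obtain p' u where p': "p = p' @ [u, l]" using b by (cases b rule: rev_cases) auto
  have ul: "{u, l} \<in> E" using p unfolding p' by (simp add: successively_append_iff)
  have "l \<noteq> k" using p unfolding p' by (cases p') auto
  \<comment> \<open>By maximality a second neighbour lies earlier on the path, and the path from
    there to \<open>l\<close> closes up to a cycle.\<close>
  have "z = u" if z: "z \<in> nbrs E l" for z
  proof (rule ccontr)
    assume "z \<noteq> u"
    with nb[OF z] nbrsD[OF z] have "z \<in> set p'" by (auto simp: p')
    then obtain xs ys where split: "p' = xs @ z # ys" by (auto simp: in_set_conv_decomp)
    have "graph_cycle E (z # ys @ [u, l])"
      using p z unfolding p' split by (auto simp: graph_cycle_def nbrs_def successively_append_iff)
    then show False using T by (auto simp: tree_def)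
  qed
  moreover have "u \<in> nbrs E l" using ul by (simp add: nbrs_def insert_commute)
  ultimately have "nbrs E l = {u}" by blast
  with lV \<open>l \<noteq> k\<close> that show thesis by blast
qed

lemma tree_remove_leaf:
  assumes T: "tree V E" and k: "k \<in> V" "k \<noteq> l" and l: "nbrs E l = {u}"
  shows "tree (V - {l}) (E - {{l, u}})"
proof -
  have s: "simple_graph V E" and conn: "graph_connected V E" and acyc: "\<And>c. \<not> graph_cycle E c"
    using T by (auto simp: tree_def)
  have leaf: "x = u" if "{l, x} \<in> E \<or> {x, l} \<in> E" for x
  proof -
    have "x \<in> nbrs E l" using that by (auto simp: nbrs_def insert_commute)
    then show ?thesis using l by simp
  qed
  have s': "simple_graph (V - {l}) (E - {{l, u}})"
    unfolding simple_graph_def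
  proof
    fix e assume e: "e \<in> E - {{l, u}}"
    then have "\<exists>x\<in>V. \<exists>y\<in>V. x \<noteq> y \<and> e = {x, y}"
      using s by (simp add: simple_graph_def)
    then obtain x y where xy: "x \<in> V" "y \<in> V" "x \<noteq> y" "e = {x, y}" by blast
    then have "{x, y} \<in> E" "{x, y} \<noteq> {l, u}" using e by auto
    then have "x \<noteq> l" "y \<noteq> l" using leaf[of x] leaf[of y] by auto
    with xy show "\<exists>x\<in>V - {l}. \<exists>y\<in>V - {l}. x \<noteq> y \<and> e = {x, y}" by blast
  qed
  moreover have "graph_connected (V - {l}) (E - {{l, u}})"
  proof (rule graph_connectedI[OF s'])
    show "k \<in> V - {l}" using k by simp
    fix S assume kS: "k \<in> S" and S: "\<And>x. x \<in> S \<Longrightarrow> nbrs (E - {{l, u}}) x \<subseteq> S"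
    \<comment> \<open>Adding \<open>l\<close> exactly when \<open>u\<close> is in \<open>S\<close>
      makes the set closed in the original graph, whose connectedness then applies.\<close>
    define S' where "S' = (S - {l}) \<union> (if u \<in> S then {l} else {})"
    have ul: "u \<noteq> l" using l s by (force simp: nbrs_def simple_graph_def)
    have "V \<subseteq> S'"
    proof (rule graph_connected_closed[OF conn k(1)])
      show "k \<in> S'" using k kS by (simp add: S'_def)
      fix x assume x: "x \<in> S'"
      show "nbrs E x \<subseteq> S'"
      proof (cases "x = l")
        case True
        then show ?thesis using x l ul by (auto simp: S'_def split: if_splits)
      next
        case False
        show ?thesis
        proof
          fix y assume y: "y \<in> nbrs E x"
          show "y \<in> S'"
          proof (cases "y = l")
            case True
            then have "x = u" using y leaf by (auto simp: nbrs_def)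
            then show ?thesis using x True False by (auto simp: S'_def split: if_splits)
          next
            case yl: False
            then have "y \<in> nbrs (E - {{l, u}}) x"
              using y False by (auto simp: nbrs_def doubleton_eq_iff)
            moreover have "x \<in> S" using x False by (auto simp: S'_def split: if_splits)
            ultimately show ?thesis using S yl by (auto simp: S'_def)
          qed
        qed
      qed
    qed
    then show "V - {l} \<subseteq> S" by (auto simp: S'_def split: if_splits)
  qed
  moreover have "\<not> graph_cycle (E - {{l, u}}) c" for c
  proof
    assume "graph_cycle (E - {{l, u}}) c"
    then have "graph_cycle E c"
      unfolding graph_cycle_def by (auto elim!: successively_mono)
    then show False using acyc by blast
  qed
  ultimately show ?thesis by (simp add: tree_def)
qed

text \<open>The extra mass 1 at \<open>k\<close> stands for the edge to the ray. The inequalities are strict, so they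
  survive when a leaf with a sufficiently light edge is added.\<close>

lemma finite_tree_weight:
  assumes "tree V E" "finite V" "k \<in> V"
  shows "\<exists>w. positive_weight E w \<and> wdeg E w k < 1 \<and>
    (\<forall>x y. {x, y} \<in> E \<longrightarrow>
      (wdeg E w x + of_bool (x = k) - w {x, y}) * (wdeg E w y + of_bool (y = k) - w {x, y}) < (w {x, y})\<^sup>2)"
  using assms
proof (induction "card V" arbitrary: V E rule: less_induct)
  case less
  interpret lf_graph V E by (rule tree_finite_lf_graph) fact+
  show ?case
  proof (cases "V = {k}")
    case True
    have "e \<notin> E" for e
    proof
      assume "e \<in> E"
      then obtain x y where "{x, y} \<in> E" by (rule edgeE)
      then show False using edgeD True by blast
    qed
    then have "E = {}" by blast
    then show ?thesis by (simp add: positive_weight_def wdeg_def nbrs_def)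
  next
    case False
    obtain l u where l: "l \<in> V" "l \<noteq> k" "nbrs E l = {u}"
      using tree_leaf[OF less.prems False] .
    define E' where "E' = E - {{l, u}}"
    have luE: "{l, u} \<in> E" using l by (auto simp: nbrs_def)
    have leaf: "x = u" if "{l, x} \<in> E \<or> {x, l} \<in> E" for x
    proof -
      have "x \<in> nbrs E l" using that by (auto simp: nbrs_def insert_commute)
      then show ?thesis using l by simp
    qed
    have T': "tree (V - {l}) E'"
      unfolding E'_def using less.prems l by (intro tree_remove_leaf[of _ _ k]) auto
    have "card (V - {l}) < card V"
      using less.prems(2) l by (intro psubset_card_mono) auto
    from less.hyps[OF this T'] obtain w where w: "positive_weight E' w" "wdeg E' w k < 1"
        "\<And>x y. {x, y} \<in> E' \<Longrightarrow> (wdeg E' w x + of_bool (x = k) - w {x, y}) *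
          (wdeg E' w y + of_bool (y = k) - w {x, y}) < (w {x, y})\<^sup>2"
      using less.prems l by auto
    \<comment> \<open>The left-hand side for an old edge after a leaf edge of weight
      \<open>\<delta>\<close> is attached at \<open>u\<close>. It is continuous in
      \<open>\<delta>\<close>, and at 0 it is the one from the induction hypothesis.\<close>
    define F where "F \<delta> x y = (wdeg E' w x + of_bool (x = u) * \<delta> + of_bool (x = k) - w {x, y}) *
        (wdeg E' w y + of_bool (y = u) * \<delta> + of_bool (y = k) - w {x, y})" for \<delta> x y
    have "eventually (\<lambda>\<delta>. \<forall>x\<in>V. \<forall>y\<in>V. {x, y} \<in> E' \<longrightarrow> F \<delta> x y < (w {x, y})\<^sup>2) (at_right 0)"
    proof (intro eventually_ball_finite ballI less.prems(2))
      fix x y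
      show "eventually (\<lambda>\<delta>. {x, y} \<in> E' \<longrightarrow> F \<delta> x y < (w {x, y})\<^sup>2) (at_right 0)"
      proof (cases "{x, y} \<in> E'")
        case True
        have "((\<lambda>\<delta>. F \<delta> x y) \<longlongrightarrow> F 0 x y) (at_right 0)"
          unfolding F_def by (intro tendsto_intros)
        moreover have "F 0 x y < (w {x, y})\<^sup>2" using w(3)[OF True] by (simp add: F_def)
        ultimately show ?thesis using True by (simp add: order_tendstoD(2))
      qed simp
    qed
    \<comment> \<open>The upper limit keeps the degree at \<open>k\<close> below 1 even when
      \<open>u = k\<close>.\<close>
    moreover have "eventually (\<lambda>\<delta>. \<delta> \<in> {0<..<1 - wdeg E' w k}) (at_right 0)"
      by (rule eventually_at_right_real) (use w(2) in simp)
    ultimately have "eventually (\<lambda>\<delta>. \<delta> \<in> {0<..<1 - wdeg E' w k} \<and>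
        (\<forall>x\<in>V. \<forall>y\<in>V. {x, y} \<in> E' \<longrightarrow> F \<delta> x y < (w {x, y})\<^sup>2)) (at_right (0 :: real))"
      by eventually_elim simp
    from eventually_happens'[OF trivial_limit_at_right_real this]
    obtain \<delta> where \<delta>01: "\<delta> \<in> {0<..<1 - wdeg E' w k}"
      and \<delta>F: "\<forall>x\<in>V. \<forall>y\<in>V. {x, y} \<in> E' \<longrightarrow> F \<delta> x y < (w {x, y})\<^sup>2" by blast
    have \<delta>: "\<delta> > 0" "wdeg E' w k + \<delta> < 1" using \<delta>01 by auto
    define w' where "w' = w({l, u} := \<delta>)"
    have w'_E': "w' e = w e" if "e \<in> E'" for e using that by (auto simp: w'_def E'_def)
    have deg: "wdeg E w' x = wdeg E' w x + of_bool (x = u) * \<delta>" if "x \<noteq> l" for x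
    proof -
      have old: "(\<Sum>y\<in>nbrs E' x. w' {x, y}) = wdeg E' w x"
        unfolding wdeg_def by (intro sum.cong) (auto simp: nbrs_def w'_E')
      show ?thesis
      proof (cases "x = u")
        case True
        have "nbrs E x = insert l (nbrs E' x)"
          using True luE by (auto simp: nbrs_def E'_def insert_commute doubleton_eq_iff)
        moreover have "l \<notin> nbrs E' x" using True by (simp add: nbrs_def E'_def insert_commute)
        moreover have "finite (nbrs E' x)" using calculation finite_nbrs[of x] by simp
        ultimately show ?thesis
          using old True by (simp add: wdeg_def w'_def insert_commute)
      next
        case False
        then have "nbrs E x = nbrs E' x"
          using that by (auto simp: nbrs_def E'_def doubleton_eq_iff)
        then show ?thesis using old False by (simp add: wdeg_def)
      qed
    qed
    have deg_l: "wdeg E w' l = \<delta>" using l by (simp add: wdeg_def w'_def)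
    \<comment> \<open>On the new edge the factor belonging to the leaf vanishes; old edges are
      covered by \<open>F\<close>.\<close>
    have "(wdeg E w' x + of_bool (x = k) - w' {x, y}) * (wdeg E w' y + of_bool (y = k) - w' {x, y})
        < (w' {x, y})\<^sup>2" if "{x, y} \<in> E" for x y
    proof (cases "{x, y} = {l, u}")
      case True
      then have "x = l \<or> y = l" "w' {x, y} = \<delta>" by (auto simp: doubleton_eq_iff w'_def)
      then show ?thesis using deg_l l \<delta>(1) by auto
    next
      case False
      then have E': "{x, y} \<in> E'" using that by (simp add: E'_def)
      have "x \<noteq> l" "y \<noteq> l" using False that leaf by (auto simp: insert_commute)
      then show ?thesis
        using \<delta>F E' edgeD[OF that] by (simp add: deg w'_E'[OF E'] F_def)
    qed
    moreover have "positive_weight E w'"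
      using w(1) \<delta>(1) by (auto simp: positive_weight_def w'_def E'_def)
    moreover have "wdeg E w' k < 1" using deg[of k] l w(2) \<delta>(2) by auto
    ultimately show ?thesis by blast
  qed
qed

section \<open>The two families of graphs and their weights\<close>

lemma double_ray_nbrs:
  assumes "inj v" "E = range (\<lambda>i :: int. {v i, v (i + 1)})"
  shows "nbrs E (v i) = {v (i - 1), v (i + 1)}"
proof
  show "nbrs E (v i) \<subseteq> {v (i - 1), v (i + 1)}"
    using inj_eq[OF assms(1)] unfolding assms(2) by (auto simp: nbrs_def doubleton_eq_iff)
  have "{v (i - 1), v (i - 1 + 1)} \<in> E" "{v i, v (i + 1)} \<in> E" unfolding assms(2) by blast+
  then show "{v (i - 1), v (i + 1)} \<subseteq> nbrs E (v i)" by (simp add: nbrs_def insert_commute)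
qed

locale tree_with_ray =
  fixes V :: "'a set" and E :: "'a set set" and VK EK k and r :: "nat \<Rightarrow> 'a"
  assumes tree: "tree VK EK" and fin: "finite VK" and k: "k \<in> VK" and inj: "inj r"
    and disj: "VK \<inter> range r = {}" and V: "V = VK \<union> range r"
    and E: "E = EK \<union> range (\<lambda>i. {r i, r (Suc i)}) \<union> {{k, r 0}}"
begin

sublocale K: lf_graph VK EK
  by (rule tree_finite_lf_graph[OF tree fin])

lemma r_notin: "r i \<notin> VK" "x \<in> VK \<Longrightarrow> x \<noteq> r i" "x \<in> VK \<Longrightarrow> r i \<noteq> x"
  using disj by auto

lemma r_eq: "r i = r j \<longleftrightarrow> i = j"
  using inj by (simp add: inj_eq)

lemma r_EK: "{r i, x} \<notin> EK" "{x, r i} \<notin> EK"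
  using K.edgeD r_notin(1) by blast+

lemma nbrs_K:
  assumes "x \<in> VK" "x \<noteq> k" shows "nbrs E x = nbrs EK x"
  using assms r_notin by (auto simp: nbrs_def E doubleton_eq_iff)

lemma nbrs_k: "nbrs E k = insert (r 0) (nbrs EK k)"
  using k r_notin by (auto simp: nbrs_def E doubleton_eq_iff)

lemma nbrs_r_0: "nbrs E (r 0) = {k, r 1}"
  using k r_notin r_EK by (auto simp: nbrs_def E doubleton_eq_iff r_eq)

lemma nbrs_r_Suc: "nbrs E (r (Suc i)) = {r i, r (Suc (Suc i))}"
  using k r_notin r_EK by (auto simp: nbrs_def E doubleton_eq_iff r_eq)

text \<open>Either \<open>k\<close> itself, if the tree is a single vertex, or a leaf of the tree
  other than \<open>k\<close>. This separates the family from double rays.\<close>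

lemma ex_degree_1: "\<exists>x\<in>V. \<exists>u. nbrs E x = {u}"
proof (cases "VK = {k}")
  case True
  have "nbrs EK k = {}" using K.nbrsD[of _ k] True by blast
  then show ?thesis using nbrs_k k V by auto
next
  case False
  then obtain l u where "l \<in> VK" "l \<noteq> k" "nbrs EK l = {u}"
    using tree_leaf[OF tree fin k] by blast
  then have "l \<in> V" "nbrs E l = {u}" using nbrs_K V by auto
  then show ?thesis by blast
qed

lemma not_double_ray: "\<not> double_ray V E"
proof
  assume "double_ray V E"
  then obtain v :: "int \<Rightarrow> 'a" where v: "inj v" "V = range v" "E = range (\<lambda>i. {v i, v (i + 1)})"
    unfolding double_ray_def by blast
  obtain x u where "x \<in> V" "nbrs E x = {u}" using ex_degree_1 by blast
  then obtain i where "nbrs E (v i) = {u}" using v(2) by auto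
  with double_ray_nbrs[OF v(1,3), of i] have "v (i - 1) = v (i + 1)" by auto
  with injD[OF v(1)] show False by fastforce
qed

lemma ex_weight:
  "\<exists>w c C. positive_weight E w \<and> c > 0 \<and> (\<forall>e\<in>E. c \<le> w e \<and> w e \<le> C) \<and>
    (\<forall>x y. {x, y} \<in> E \<longrightarrow> (wdeg E w x - w {x, y}) * (wdeg E w y - w {x, y}) \<le> (w {x, y})\<^sup>2)"
proof -
  obtain u where u: "positive_weight EK u" "wdeg EK u k < 1"
    "\<And>x y. {x, y} \<in> EK \<Longrightarrow> (wdeg EK u x + of_bool (x = k) - u {x, y}) *
      (wdeg EK u y + of_bool (y = k) - u {x, y}) < (u {x, y})\<^sup>2"
    using finite_tree_weight[OF tree fin k] by blast
  define w where "w e = (if e \<in> EK then u e else 1)" for e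
  have old: "(\<Sum>y\<in>nbrs EK x. w {x, y}) = wdeg EK u x" for x
    unfolding wdeg_def by (intro sum.cong) (auto simp: nbrs_def w_def)
  have deg_K: "wdeg E w x = wdeg EK u x + of_bool (x = k)" if "x \<in> VK" for x
  proof (cases "x = k")
    case True
    have "r 0 \<notin> nbrs EK k" using r_EK by (simp add: nbrs_def)
    then show ?thesis using True old[of k] K.finite_nbrs[of k] r_EK by (simp add: wdeg_def nbrs_k w_def)
  next
    case False
    then show ?thesis using old[of x] nbrs_K[OF that] by (simp add: wdeg_def)
  qed
  have deg_r: "wdeg E w (r i) = 2" for i
  proof (cases i)
    case 0
    then show ?thesis using r_notin k r_EK by (simp add: wdeg_def nbrs_r_0 w_def)
  next
    case (Suc j)
    then show ?thesis using r_EK by (simp add: wdeg_def nbrs_r_Suc w_def r_eq)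
  qed
  define good where "good x y \<longleftrightarrow>
    (wdeg E w x - w {x, y}) * (wdeg E w y - w {x, y}) \<le> (w {x, y})\<^sup>2" for x y
  have good_sym: "good x y \<longleftrightarrow> good y x" for x y
    by (simp add: good_def insert_commute mult.commute)
  \<comment> \<open>The factor at \<open>r 0\<close> is 2 - 1 = 1, and the one at \<open>k\<close>
    is the degree inside the tree, which was kept below 1 for this purpose.\<close>
  have good_k: "good k (r 0)"
    using u(2) k r_EK deg_r deg_K[OF k] by (simp add: good_def w_def)
  have good_r: "good (r i) (r (Suc i))" for i
    using r_EK deg_r by (simp add: good_def w_def)
  have good_K: "good x y" if "{x, y} \<in> EK" for x y
    using u(3)[OF that] K.edgeD[OF that] that by (simp add: good_def deg_K w_def)
  have "good x y" if "{x, y} \<in> E" for x y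
    using that good_k good_r good_K good_sym unfolding E by (auto simp: doubleton_eq_iff)
  moreover have "finite EK"
  proof (rule finite_subset)
    show "EK \<subseteq> Pow VK" using K.simple by (auto simp: simple_graph_def)
  qed (use fin in simp)
  \<comment> \<open>Inserting 1 covers the edges of weight 1 and keeps the set nonempty when the
    tree has no edges.\<close>
  define c where "c = Min (insert 1 (u ` EK))"
  define C where "C = Max (insert 1 (u ` EK))"
  have "c > 0" using u(1) \<open>finite EK\<close> by (auto simp: c_def positive_weight_def)
  moreover have "c \<le> w e \<and> w e \<le> C" for e
    using \<open>finite EK\<close> by (auto simp: c_def C_def w_def)
  moreover have "positive_weight E w" using u(1) by (auto simp: positive_weight_def w_def)
  ultimately show ?thesis unfolding good_def by blast
qed

end

lemma finite_tree_with_ray_iff: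
  "finite_tree_with_ray V E \<longleftrightarrow> (\<exists>VK EK k r. tree_with_ray V E VK EK k r)"
  by (simp only: finite_tree_with_ray_def tree_with_ray_def conj_assoc)

text \<open>With these degrees the constant weight gives equality, 1 = 1, in the inequality of
  \<open>admissible_iff\<close>.\<close>

lemma double_ray_weight:
  assumes "double_ray V E" "{x, y} \<in> E"
  shows "wdeg E (\<lambda>_. 1) x = 2"
proof -
  obtain v :: "int \<Rightarrow> 'a" where v: "inj v" "E = range (\<lambda>i. {v i, v (i + 1)})"
    using assms(1) unfolding double_ray_def by blast
  obtain i where "x = v i" using assms(2) v(2) by (auto simp: doubleton_eq_iff)
  moreover have "v (i - 1) \<noteq> v (i + 1)" for i using injD[OF v(1), of "i - 1" "i + 1"] by auto
  ultimately show ?thesis by (simp add: wdeg_def double_ray_nbrs[OF v])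
qed

section \<open>Finite distortion and the equivalence\<close>

lemma DN_LLY_finite:
  assumes "admissible V E w" "c > 0" "\<And>e. e \<in> E \<Longrightarrow> c \<le> w e \<and> w e \<le> C" "E \<noteq> {}"
  shows "DN_LLY V E < \<infinity>"
proof -
  have "c \<le> (INF e\<in>E. w e)" using assms by (intro cINF_greatest) auto
  moreover have "bdd_above (w ` E)" using assms(3) by (intro bdd_aboveI[of _ C]) auto
  ultimately have "distortion E w < \<infinity>" using assms(2) by (simp add: distortion_def)
  moreover have "DN_LLY V E \<le> distortion E w"
    unfolding DN_LLY_def using assms(1) by (intro INF_lower) auto
  ultimately show ?thesis by (rule le_less_trans[rotated])
qed

text \<open>Finite distortion only says that the infimum is nonzero; positivity of the weight makes
  it strictly positive. Infimum and supremum then serve as \<open>c\<close> and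
  \<open>C\<close>.\<close>

lemma (in girth6_graph) DN_LLY_finiteD:
  assumes "DN_LLY V E < \<infinity>" "E \<noteq> {}"
  shows "\<exists>w c C. log_concave_weight V E w c C"
proof -
  have "\<exists>w\<in>{w. admissible V E w}. distortion E w < \<infinity>"
    using assms(1) unfolding DN_LLY_def by (simp only: INF_less_iff)
  then obtain w where w: "admissible V E w" "distortion E w < \<infinity>" by blast
  have pos: "w e > 0" if "e \<in> E" for e using w(1) that by (auto simp: admissible_iff positive_weight_def)
  have bdd: "bdd_above (w ` E)" "(INF e\<in>E. w e) \<noteq> 0"
    using w(2) by (auto simp: distortion_def split: if_splits)
  have below: "bdd_below (w ` E)" using pos by (intro bdd_belowI[of _ 0]) (auto intro: less_imp_le)
  have "0 \<le> (INF e\<in>E. w e)" using pos assms(2) by (intro cINF_greatest) (auto intro: less_imp_le)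
  with bdd(2) have "(INF e\<in>E. w e) > 0" by simp
  moreover have "(INF e\<in>E. w e) \<le> w e" "w e \<le> (SUP e\<in>E. w e)" if "e \<in> E" for e
    using that bdd(1) below by (auto intro: cINF_lower cSUP_upper)
  ultimately have "log_concave_weight V E w (INF e\<in>E. w e) (SUP e\<in>E. w e)"
    using w(1) by unfold_locales (auto simp: admissible_iff)
  then show ?thesis by blast
qed

theorem corollary6p7:
  fixes V :: "'a set" and E :: "'a set set"
  assumes "simple_graph V E"
    and "graph_connected V E"
    and "locally_finite V E"
    and "infinite V"
    and "girth E \<ge> 6"
  shows "DN_LLY V E < \<infinity> \<longleftrightarrow>
    (double_ray V E \<and> \<not> finite_tree_with_ray V E) \<or>
    (\<not> double_ray V E \<and> finite_tree_with_ray V E)"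
proof -
  interpret girth6_graph V E using assms by unfold_locales
  obtain v where "v \<in> V" using conn by (auto simp: graph_connected_def)
  \<comment> \<open>Infima and suprema of reals over \<open>E\<close> are meaningful only for
    nonempty \<open>E\<close>.\<close>
  then have ne: "E \<noteq> {}" using ex_escapes[OF assms(4)] by (auto simp: escapes_def)
  \<comment> \<open>Disjointness of the two families reduces "exactly one" to a plain
    disjunction.\<close>
  have excl: "\<not> double_ray V E" if "finite_tree_with_ray V E"
    using that tree_with_ray.not_double_ray by (metis finite_tree_with_ray_iff)
  have "DN_LLY V E < \<infinity>" if "double_ray V E"
  proof (rule DN_LLY_finite)
    have "wdeg E (\<lambda>_. 1) x = 2 \<and> wdeg E (\<lambda>_. 1) y = 2" if "{x, y} \<in> E" for x y
      using double_ray_weight[OF \<open>double_ray V E\<close>, of x y]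
        double_ray_weight[OF \<open>double_ray V E\<close>, of y x] that
      by (simp add: insert_commute)
    then show "admissible V E (\<lambda>_. 1)"
      by (simp add: admissible_iff positive_weight_def)
  qed (use ne in auto)
  moreover have "DN_LLY V E < \<infinity>" if "finite_tree_with_ray V E"
  proof -
    from that obtain VK EK k r where "tree_with_ray V E VK EK k r"
      unfolding finite_tree_with_ray_iff by blast
    from tree_with_ray.ex_weight[OF this] obtain w c C where
      "positive_weight E w" "c > 0" "\<forall>e\<in>E. c \<le> w e \<and> w e \<le> C"
      "\<forall>x y. {x, y} \<in> E \<longrightarrow> (wdeg E w x - w {x, y}) * (wdeg E w y - w {x, y}) \<le> (w {x, y})\<^sup>2"
      by blast
    then show ?thesis using ne by (intro DN_LLY_finite[of V E w c C]) (auto simp: admissible_iff)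
  qed
  moreover have "double_ray V E \<or> finite_tree_with_ray V E" if "DN_LLY V E < \<infinity>"
    using DN_LLY_finiteD[OF that ne] log_concave_weight.double_ray_or_finite_tree_with_ray assms(4) by blast
  ultimately show ?thesis using excl by blast
qed

end
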